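(* Let $q$ be a prime power and $m\ge 1$ a natural number. Let $(T_q^m)^*$ be the group of invertible elements of the monoid $T_q^m$. Then there is an isomorphism of groups $$(T_q^m)^*\;\cong\;\prod_{k\mid m}\left(\mathcal{S}_{\pi(k)}\ltimes_\Gamma C_k^{\pi(k)}\right),$$ where the (direct) product runs over all positive divisors $k$ of $m$ and $\mathcal{S}_{\pi(k)}$ is the group of permutations of $\pi(k)$ elements.
   Context: A map $f:\mathbb{F}_{q^m}\to\mathbb{F}_{q^m}$ is called subfield preserving if $f(\mathbb{F}_q)\subseteq\mathbb{F}_q$ and, for all positive divisors $d,s$ of $m$, $f(\mathbb{F}_{q^d}\setminus\mathbb{F}_{q^s})\subseteq\mathbb{F}_{q^d}\setminus\mathbb{F}_{q^s}$. $T_q^m$ denotes the set of subfield preserving maps $f:\mathbb{F}_{q^m}\to\mathbb{F}_{q^m}$ whose polynomial representation (the unique polynomial of degree less than $q^m$ inducing $f$) has coefficients in $\mathbb{F}_q$; it is a monoid under composition. $\pi(k)$ is the number of monic irreducible polynomials of degree $k$ over $\mathbb{F}_q$, i.e. $\pi(k)=\frac1k\sum_{j\mid k}\mu(k/j)q^j$ with $\mu$ the Möbius function. $C_k$ is the cyclic group of order $k$, and $\mathcal{S}_n$ is the group (under composition) of permutations of $\{1,\dots,n\}$. Semidirect product: given monoids $M,N$ and an antihomomorphism of monoids $\Gamma:M\to\operatorname{End}(N)$, $m\mapsto\Gamma_m$ (so $\Gamma_{m_1m_2}=\Gamma_{m_2}\circ\Gamma_{m_1}$), $M\ltimes_\Gamma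 N$ is the monoid with underlying set $M\times N$ and operation $(m_1,n_1)*(m_2,n_2)=(m_1m_2,\Gamma_{m_2}(n_1)\,n_2)$. Here $\Gamma:\mathcal{S}_n\to\operatorname{End}(C_k^n)$ is given by $\Gamma_\sigma(\gamma_1,\dots,\gamma_n)=(\gamma_{\sigma(1)},\dots,\gamma_{\sigma(n)})$, with $n=\pi(k)$. *)

theory Defs
  imports
    "HOL-Number_Theory.Prime_Powers"
    "HOL-Algebra.Polynomial_Divisibility"
    "HOL-Algebra.Elementary_Groups"
    "HOL-Algebra.Product_Groups"
    "HOL-Algebra.Sym_Groups"
begin

text \<open>
  Throughout, \<open>R\<close> is a field with \<open>q ^ m\<close> elements. For \<open>d dvd m\<close> the field with
  \<open>q ^ d\<close> elements is the unique subfield of \<open>R\<close> of that cardinality.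
\<close>

definition subfield_of_card :: "('a, 'b) ring_scheme \<Rightarrow> nat \<Rightarrow> 'a set"
  where "subfield_of_card R n = (THE K. subfield K R \<and> card K = n)"

definition subfield_preserving ::
    "('a, 'b) ring_scheme \<Rightarrow> nat \<Rightarrow> nat \<Rightarrow> ('a \<Rightarrow> 'a) \<Rightarrow> bool"
  where "subfield_preserving R q m f \<longleftrightarrow>
    f ` subfield_of_card R q \<subseteq> subfield_of_card R q \<and>
    (\<forall>d s. d dvd m \<longrightarrow> s dvd m \<longrightarrow>
      f ` (subfield_of_card R (q ^ d) - subfield_of_card R (q ^ s))
        \<subseteq> subfield_of_card R (q ^ d) - subfield_of_card R (q ^ s))"

text \<open>
  Polynomials are lists of coefficients, leading coefficient first and nonzero;
  \<open>degree\<close> is \<open>length - 1\<close>, so the zero polynomial \<open>[]\<close> has degree \<open>0\<close>.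
\<close>

definition poly_representation :: "('a, 'b) ring_scheme \<Rightarrow> ('a \<Rightarrow> 'a) \<Rightarrow> 'a list"
  where "poly_representation R f =
    (THE p. p \<in> carrier (poly_ring R) \<and> degree p < card (carrier R) \<and>
            (\<forall>x \<in> carrier R. ring.eval R p x = f x))"

text \<open>
  Maps from \<open>carrier R\<close> to itself are represented by extensional functions, so that
  equality of maps is equality in HOL.
\<close>

definition T_monoid :: "('a, 'b) ring_scheme \<Rightarrow> nat \<Rightarrow> nat \<Rightarrow> ('a \<Rightarrow> 'a) monoid"
  where "T_monoid R q m =
    \<lparr>carrier = {f \<in> carrier R \<rightarrow>\<^sub>E carrier R.
        subfield_preserving R q m f \<and>
        set (poly_representation R f) \<subseteq> subfield_of_card R q},
     mult = compose (carrier R),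
     one = (\<lambda>x\<in>carrier R. x)\<rparr>"

definition num_monic_irreducible :: "('a, 'b) ring_scheme \<Rightarrow> nat \<Rightarrow> nat \<Rightarrow> nat"
  where "num_monic_irreducible R q k =
    card {p \<in> carrier ((subfield_of_card R q) [X]\<^bsub>R\<^esub>).
            pirreducible\<^bsub>R\<^esub> (subfield_of_card R q) p \<and>
            degree p = k \<and> lead_coeff p = \<one>\<^bsub>R\<^esub>}"

text \<open>
  Here \<open>\<Gamma>\<close> is meant to be an antihomomorphism from \<open>M\<close> to the endomorphisms of \<open>N\<close>.
\<close>

definition semidirect_product ::
    "('m, 'c) monoid_scheme \<Rightarrow> ('m \<Rightarrow> 'n \<Rightarrow> 'n) \<Rightarrow> ('n, 'd) monoid_scheme \<Rightarrow> ('m \<times> 'n) monoid"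
  where "semidirect_product M \<Gamma> N =
    \<lparr>carrier = carrier M \<times> carrier N,
     mult = (\<lambda>(m1, n1) (m2, n2). (m1 \<otimes>\<^bsub>M\<^esub> m2, \<Gamma> m2 n1 \<otimes>\<^bsub>N\<^esub> n2)),
     one = (\<one>\<^bsub>M\<^esub>, \<one>\<^bsub>N\<^esub>)\<rparr>"

definition cyclic_power :: "nat \<Rightarrow> nat \<Rightarrow> (nat \<Rightarrow> int) monoid"
  where "cyclic_power k n = product_group {1..n} (\<lambda>_. integer_mod_group k)"

definition permute_coords :: "nat \<Rightarrow> (nat \<Rightarrow> nat) \<Rightarrow> (nat \<Rightarrow> int) \<Rightarrow> (nat \<Rightarrow> int)"
  where "permute_coords n \<sigma> \<gamma> = (\<lambda>i\<in>{1..n}. \<gamma> (\<sigma> i))"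

definition sym_semidirect_cyclic :: "nat \<Rightarrow> nat \<Rightarrow> ((nat \<Rightarrow> nat) \<times> (nat \<Rightarrow> int)) monoid"
  where "sym_semidirect_cyclic n k =
    semidirect_product (sym_group n) (permute_coords n) (cyclic_power k n)"

end

theory Submission
  imports Defs "HOL-Number_Theory.Cong" "HOL-Algebra.Finite_Extensions"
begin

text \<open>
  A self-map of the field \<open>R\<close> with \<open>q ^ m\<close> elements has its interpolation polynomial over the
  subfield with \<open>q\<close> elements iff it commutes with \<open>x \<mapsto> x ^ q\<close>, since applying Frobenius to the
  coefficients must not change the polynomial. The subfields of \<open>R\<close> are the fixed sets of powers of
  Frobenius, so a bijection commuting with Frobenius preserves them automatically. Hence the units
  of the monoid form the centralizer of Frobenius in the symmetric group of \<open>R\<close>. An element of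
  that centralizer permutes the orbits of each length \<open>k\<close> and, relative to chosen base points,
  rotates each of them, which yields the wreath products. Finally, sending an orbit to the minimal
  polynomial of its points is a bijection from the orbits of length \<open>k\<close> onto the monic irreducible
  polynomials of degree \<open>k\<close>.
\<close>

subsection \<open>Centralizers of periodic maps\<close>

text \<open>Extensional functions, \<open>compose\<close> and the restricted identity match the
  encoding of \<open>T_monoid\<close>, so that its group of units will be equal to such a
  centralizer and not merely isomorphic.\<close>

definition bij_centralizer :: "'a set \<Rightarrow> ('a \<Rightarrow> 'a) \<Rightarrow> ('a \<Rightarrow> 'a) monoid"
  where "bij_centralizer A \<phi> =
    \<lparr>carrier = {f \<in> A \<rightarrow>\<^sub>E A. bij_betw f A A \<and> (\<forall>x\<in>A. f (\<phi> x) = \<phi> (f x))},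
     mult = compose A,
     one = (\<lambda>x\<in>A. x)\<rparr>"

lemma mult_bij_centralizer: "f \<otimes>\<^bsub>bij_centralizer A \<phi>\<^esub> g = compose A f g"
  by (simp add: bij_centralizer_def)

text \<open>The isomorphism is built from the wreath product to the centralizer. Closure of the
  source under multiplication is what allows it to be turned around.\<close>

lemma iso_inv_into:
  assumes "h \<in> iso G H"
    and closed: "\<And>x y. x \<in> carrier G \<Longrightarrow> y \<in> carrier G \<Longrightarrow> x \<otimes>\<^bsub>G\<^esub> y \<in> carrier G"
  shows "inv_into (carrier G) h \<in> iso H G"
proof -
  let ?g = "inv_into (carrier G) h"
  have h: "h \<in> hom G H" and bij: "bij_betw h (carrier G) (carrier H)"
    using assms(1) by (auto simp: iso_def)
  have g: "?g u \<in> carrier G" "h (?g u) = u" if "u \<in> carrier H" for u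
    using bij that by (auto simp: bij_betw_def inv_into_into f_inv_into_f)
  have "?g (u \<otimes>\<^bsub>H\<^esub> v) = ?g u \<otimes>\<^bsub>G\<^esub> ?g v" if "u \<in> carrier H" "v \<in> carrier H" for u v
  proof -
    have "u \<otimes>\<^bsub>H\<^esub> v = h (?g u \<otimes>\<^bsub>G\<^esub> ?g v)"
      using h g that by (simp add: hom_def)
    then show ?thesis
      using bij closed g that by (simp add: bij_betw_def)
  qed
  then show ?thesis
    using bij_betw_inv_into[OF bij] g(1) by (simp add: iso_def hom_def)
qed

section \<open>Explicit form of the semidirect products\<close>

lemma carrier_sym_semidirect_cyclic:
  "carrier (sym_semidirect_cyclic n k) =
    {\<sigma>. \<sigma> permutes {1..n}} \<times> ({1..n} \<rightarrow>\<^sub>E carrier (integer_mod_group k))"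
  by (auto simp: sym_semidirect_cyclic_def semidirect_product_def cyclic_power_def sym_group_def)

lemma mult_sym_semidirect_cyclic:
  "(\<sigma>, \<gamma>) \<otimes>\<^bsub>sym_semidirect_cyclic n k\<^esub> (\<tau>, \<delta>) =
    (\<sigma> \<circ> \<tau>, \<lambda>i\<in>{1..n}. (\<gamma> (\<tau> i) + \<delta> i) mod int k)"
  by (auto simp: sym_semidirect_cyclic_def semidirect_product_def cyclic_power_def sym_group_def
      permute_coords_def fun_eq_iff)

lemma sym_semidirect_cyclic_closed:
  assumes "k > 0" "x \<in> carrier (sym_semidirect_cyclic n k)" "y \<in> carrier (sym_semidirect_cyclic n k)"
  shows "x \<otimes>\<^bsub>sym_semidirect_cyclic n k\<^esub> y \<in> carrier (sym_semidirect_cyclic n k)"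
  using assms
  by (cases x; cases y)
    (auto simp: carrier_sym_semidirect_cyclic mult_sym_semidirect_cyclic carrier_integer_mod_group
      intro: permutes_compose)

section \<open>Periods and orbits of a periodic map\<close>

definition period :: "('a \<Rightarrow> 'a) \<Rightarrow> 'a \<Rightarrow> nat"
  where "period \<phi> x = (LEAST j. 0 < j \<and> (\<phi> ^^ j) x = x)"

lemma funpow_comp_apply: "(f ^^ a) ((f ^^ b) x) = (f ^^ (a + b)) x"
  by (simp add: funpow_add)

locale periodic_action =
  fixes A :: "'a set" and \<phi> :: "'a \<Rightarrow> 'a" and m :: nat
  assumes finite_A: "finite A" and m_pos: "m > 0"
    and closed: "x \<in> A \<Longrightarrow> \<phi> x \<in> A"
    and periodic: "x \<in> A \<Longrightarrow> (\<phi> ^^ m) x = x"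
begin

lemma funpow_closed: "x \<in> A \<Longrightarrow> (\<phi> ^^ a) x \<in> A"
  by (induction a) (auto simp: closed)

lemma period_pos: "x \<in> A \<Longrightarrow> 0 < period \<phi> x"
  and funpow_period: "x \<in> A \<Longrightarrow> (\<phi> ^^ period \<phi> x) x = x"
  using LeastI[of "\<lambda>j. 0 < j \<and> (\<phi> ^^ j) x = x" m] m_pos periodic by (auto simp: period_def)

lemma funpow_mod_period: 
  assumes "x \<in> A"
  shows "(\<phi> ^^ (a mod period \<phi> x)) x = (\<phi> ^^ a) x"
  using funpow_mod_eq[OF funpow_period[OF assms]] .

text \<open>Otherwise the remainder of \<open>a\<close> modulo the period would be a smaller
  positive return time.\<close>

lemma funpow_id_iff:
  assumes "x \<in> A"
  shows "(\<phi> ^^ a) x = x \<longleftrightarrow> period \<phi> x dvd a"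
proof
  assume a: "(\<phi> ^^ a) x = x"
  show "period \<phi> x dvd a"
  proof (rule ccontr)
    assume "\<not> period \<phi> x dvd a"
    then have "0 < a mod period \<phi> x"
      by (simp add: dvd_eq_mod_eq_0)
    moreover have "(\<phi> ^^ (a mod period \<phi> x)) x = x"
      using a funpow_mod_period[OF assms] by simp
    ultimately have "period \<phi> x \<le> a mod period \<phi> x"
      unfolding period_def by (intro Least_le) auto
    then show False
      using mod_less_divisor[OF period_pos[OF assms], of a] by simp
  qed
next
  assume "period \<phi> x dvd a"
  then show "(\<phi> ^^ a) x = x"
    using funpow_mod_period[OF assms, of a] by (simp add: dvd_eq_mod_eq_0)
qed

lemma period_dvd: "x \<in> A \<Longrightarrow> period \<phi> x dvd m"
  using funpow_id_iff periodic by blast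

text \<open>After \<open>a\<close> steps, another \<open>m * a - a\<close> steps complete
  \<open>m * a\<close> steps and bring every point back, so \<open>\<phi> ^^ a\<close> has a left
  inverse on \<open>A\<close>.\<close>

lemma funpow_inj:
  assumes "x \<in> A" "y \<in> A" "(\<phi> ^^ a) x = (\<phi> ^^ a) y"
  shows "x = y"
proof -
  have *: "(\<phi> ^^ (m * a - a)) ((\<phi> ^^ a) z) = z" if "z \<in> A" for z
  proof -
    have "m * a - a + a = m * a"
      using m_pos by simp
    then have "(\<phi> ^^ (m * a - a)) ((\<phi> ^^ a) z) = (\<phi> ^^ (m * a)) z"
      by (metis funpow_comp_apply)
    also have "\<dots> = z"
      using that period_dvd funpow_id_iff by (meson dvd_mult2)
    finally show ?thesis .
  qed
  show ?thesis
    using *[OF assms(1)] *[OF assms(2)] assms(3) by metis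
qed

lemma period_cong:
  assumes "\<And>a. (\<phi> ^^ a) x = x \<longleftrightarrow> (\<phi> ^^ a) y = y"
  shows "period \<phi> x = period \<phi> y"
  using assms by (simp add: period_def)

lemma period_funpow:
  assumes "x \<in> A"
  shows "period \<phi> ((\<phi> ^^ a) x) = period \<phi> x"
proof (rule period_cong)
  fix b
  have "(\<phi> ^^ b) ((\<phi> ^^ a) x) = (\<phi> ^^ a) ((\<phi> ^^ b) x)"
    by (simp add: funpow_comp_apply add.commute)
  then show "(\<phi> ^^ b) ((\<phi> ^^ a) x) = (\<phi> ^^ a) x \<longleftrightarrow> (\<phi> ^^ b) x = x"
    using funpow_inj assms funpow_closed by metis
qed

text \<open>By symmetry let \<open>c \<le> d\<close>. Injectivity cancels \<open>\<phi> ^^ c\<close>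
  and leaves a return to \<open>x\<close> after \<open>d - c\<close> steps.\<close>

lemma funpow_eq_iff:
  assumes "x \<in> A"
  shows "(\<phi> ^^ a) x = (\<phi> ^^ b) x \<longleftrightarrow> a mod period \<phi> x = b mod period \<phi> x"
proof -
  have *: "(\<phi> ^^ c) x = (\<phi> ^^ d) x \<longleftrightarrow> c mod period \<phi> x = d mod period \<phi> x" if "c \<le> d" for c d
  proof -
    have "(\<phi> ^^ d) x = (\<phi> ^^ c) ((\<phi> ^^ (d - c)) x)"
      using that by (simp add: funpow_comp_apply)
    then have "(\<phi> ^^ c) x = (\<phi> ^^ d) x \<longleftrightarrow> (\<phi> ^^ (d - c)) x = x"
      using funpow_inj assms funpow_closed by metis
    also have "\<dots> \<longleftrightarrow> c mod period \<phi> x = d mod period \<phi> x"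
      using funpow_id_iff[OF assms] mod_eq_dvd_iff_nat[OF that, of "period \<phi> x"] by metis
    finally show ?thesis .
  qed
  then show ?thesis
    by (metis nle_le)
qed

lemma commute_funpow:
  assumes "\<forall>x\<in>A. f (\<phi> x) = \<phi> (f x)" "x \<in> A"
  shows "f ((\<phi> ^^ a) x) = (\<phi> ^^ a) (f x)"
  using assms by (induction a) (auto simp: funpow_closed)

text \<open>Commuting carries a return of \<open>x\<close> over to \<open>f x\<close>, and
  injectivity carries it back.\<close>

lemma period_commute:
  assumes "\<forall>x\<in>A. f (\<phi> x) = \<phi> (f x)" "inj_on f A" "x \<in> A"
  shows "period \<phi> (f x) = period \<phi> x"
proof (rule period_cong)
  fix a
  show "(\<phi> ^^ a) (f x) = f x \<longleftrightarrow> (\<phi> ^^ a) x = x"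
    using commute_funpow[OF assms(1,3), of a] assms(2,3) funpow_closed[OF assms(3), of a]
    by (metis inj_onD)
qed

end

text \<open>
  \<open>L\<close> is a complete invariant of the orbits, so counting its values on the points of period \<open>k\<close>
  counts the orbits of length \<open>k\<close>. For the Frobenius map it will be the minimal polynomial.
\<close>

locale labelled_action = periodic_action A \<phi> m
  for A :: "'a set" and \<phi> and m +
  fixes L :: "'a \<Rightarrow> 'l" and n :: "nat \<Rightarrow> nat"
  assumes label: "x \<in> A \<Longrightarrow> y \<in> A \<Longrightarrow> L x = L y \<longleftrightarrow> (\<exists>a. y = (\<phi> ^^ a) x)"
    and card_label: "k dvd m \<Longrightarrow> n k = card (L ` {x \<in> A. period \<phi> x = k})"
begin

text \<open>A choice of one base point on each orbit: since \<open>L\<close> separates the orbits,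
  bijectivity of \<open>L \<circ> r k\<close> says that every orbit of length \<open>k\<close> is
  met exactly once.\<close>

definition base :: "nat \<Rightarrow> nat \<Rightarrow> 'a"
  where "base = (SOME r. \<forall>k. k dvd m \<longrightarrow> r k \<in> {1..n k} \<rightarrow> {x \<in> A. period \<phi> x = k} \<and>
    bij_betw (L \<circ> r k) {1..n k} (L ` {x \<in> A. period \<phi> x = k}))"

lemma base_props:
  assumes "k dvd m"
  shows "base k \<in> {1..n k} \<rightarrow> {x \<in> A. period \<phi> x = k}"
    and "bij_betw (L \<circ> base k) {1..n k} (L ` {x \<in> A. period \<phi> x = k})"
proof -
  have "\<exists>r. r \<in> {1..n k} \<rightarrow> {x \<in> A. period \<phi> x = k} \<and>
    bij_betw (L \<circ> r) {1..n k} (L ` {x \<in> A. period \<phi> x = k})" if k: "k dvd m" for k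
  proof -
    let ?Y = "{x \<in> A. period \<phi> x = k}"
    have "finite (L ` ?Y)"
      using finite_A by simp
    from ex_bij_betw_nat_finite_1[OF this] obtain b where b: "bij_betw b {1..n k} (L ` ?Y)"
      unfolding card_label[OF k] by blast
    \<comment> \<open>With the labels enumerated by \<open>b\<close>, base point \<open>i\<close> is
      any point of period \<open>k\<close> that carries the \<open>i\<close>-th label.\<close>
    let ?r = "\<lambda>i. inv_into ?Y L (b i)"
    have r: "?r i \<in> ?Y" "L (?r i) = b i" if "i \<in> {1..n k}" for i
      using inv_into_into[OF bij_betw_apply[OF b that]] f_inv_into_f[OF bij_betw_apply[OF b that]]
      by simp_all
    have "bij_betw (L \<circ> ?r) {1..n k} (L ` ?Y)"
      using b by (rule bij_betw_cong[THEN iffD2, rotated]) (simp add: r(2) del: atLeastAtMost_iff)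
    then show ?thesis
      using r(1) by (intro exI[of _ ?r]) blast
  qed
  then have "\<forall>k. \<exists>r. k dvd m \<longrightarrow> r \<in> {1..n k} \<rightarrow> {x \<in> A. period \<phi> x = k} \<and>
    bij_betw (L \<circ> r) {1..n k} (L ` {x \<in> A. period \<phi> x = k})"
    by blast
  from choice[OF this] have "\<exists>r. \<forall>k. k dvd m \<longrightarrow> r k \<in> {1..n k} \<rightarrow> {x \<in> A. period \<phi> x = k} \<and>
    bij_betw (L \<circ> r k) {1..n k} (L ` {x \<in> A. period \<phi> x = k})" .
  from someI_ex[OF this, folded base_def] assms
  show "base k \<in> {1..n k} \<rightarrow> {x \<in> A. period \<phi> x = k}"
    and "bij_betw (L \<circ> base k) {1..n k} (L ` {x \<in> A. period \<phi> x = k})"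
    by blast+
qed

text \<open>
  The points \<open>coord k i a\<close> with \<open>i \<in> {1..n k}\<close> and \<open>a\<close> modulo \<open>k\<close> enumerate the points of
  period \<open>k\<close>, and \<open>\<phi>\<close> adds \<open>1\<close> to \<open>a\<close>.
\<close>

definition coord :: "nat \<Rightarrow> nat \<Rightarrow> nat \<Rightarrow> 'a"
  where "coord k i a = (\<phi> ^^ a) (base k i)"

context
  fixes k i assumes k: "k dvd m" and i: "i \<in> {1..n k}"
begin

lemma base_closed: "base k i \<in> A" and period_base: "period \<phi> (base k i) = k"
  using base_props(1)[OF k] i by auto

lemma coord_closed: "coord k i a \<in> A"
  by (simp add: coord_def funpow_closed base_closed)

lemma period_coord: "period \<phi> (coord k i a) = k"
  by (simp add: coord_def period_funpow base_closed period_base)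

end

lemma funpow_coord: "(\<phi> ^^ b) (coord k i a) = coord k i (b + a)"
  by (simp add: coord_def funpow_add)

text \<open>The period of the point recovers \<open>k\<close>, its label recovers \<open>i\<close>
  because base points have distinct labels, and \<open>funpow_eq_iff\<close> then determines
  \<open>a\<close> modulo \<open>k\<close>.\<close>

lemma coord_eq_iff:
  assumes "k dvd m" "i \<in> {1..n k}" "k' dvd m" "i' \<in> {1..n k'}"
  shows "coord k i a = coord k' i' a' \<longleftrightarrow> k = k' \<and> i = i' \<and> a mod k = a' mod k"
proof
  assume eq: "coord k i a = coord k' i' a'"
  then have k: "k = k'"
    using period_coord assms by metis
  have "L (coord k i a) = L (base k i)" "L (coord k i' a') = L (base k i')"
    using label base_closed coord_closed assms k unfolding coord_def by metis+
  then have "(L \<circ> base k) i = (L \<circ> base k) i'"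
    using eq k by simp
  then have i: "i = i'"
    using bij_betw_imp_inj_on[OF base_props(2)[OF assms(1)]] assms(2,4) k by (auto dest: inj_onD simp del: comp_apply atLeastAtMost_iff)
  show "k = k' \<and> i = i' \<and> a mod k = a' mod k"
    using eq k i funpow_eq_iff[OF base_closed[OF assms(1,2)]] period_base[OF assms(1,2)]
    by (simp add: coord_def)
next
  assume "k = k' \<and> i = i' \<and> a mod k = a' mod k"
  then show "coord k i a = coord k' i' a'"
    using funpow_eq_iff[OF base_closed[OF assms(1,2)]] period_base[OF assms(1,2)]
    by (auto simp: coord_def)
qed

text \<open>Some base point of the same period shares the label of \<open>x\<close>, hence its
  orbit.\<close>

lemma coord_exists:
  assumes "x \<in> A"
  shows "\<exists>i\<in>{1..n (period \<phi> x)}. \<exists>a. x = coord (period \<phi> x) i a"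
proof -
  let ?k = "period \<phi> x"
  have k: "?k dvd m"
    using assms by (rule period_dvd)
  have "L x \<in> (L \<circ> base ?k) ` {1..n ?k}"
    unfolding bij_betw_imp_surj_on[OF base_props(2)[OF k]] using assms by simp
  then obtain i where i: "i \<in> {1..n ?k}" "L (base ?k i) = L x"
    by (elim imageE) simp
  then show ?thesis
    unfolding coord_def label[OF base_closed[OF k i(1)] assms] by blast
qed

lemma coordE:
  assumes "x \<in> A"
  obtains k i a where "k dvd m" "i \<in> {1..n k}" "x = coord k i a"
  using coord_exists[OF assms] period_dvd[OF assms] by blast

section \<open>The action of the wreath product: permuting orbits and rotating them\<close>

definition wreath_map :: "(nat \<Rightarrow> (nat \<Rightarrow> nat) \<times> (nat \<Rightarrow> int)) \<Rightarrow> 'a \<Rightarrow> 'a"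
  where "wreath_map F = (\<lambda>x\<in>A. THE y. \<exists>k i a. k dvd m \<and> i \<in> {1..n k} \<and> x = coord k i a \<and>
    y = coord k (fst (F k) i) (a + nat (snd (F k) i)))"

abbreviation wreath_product :: "(nat \<Rightarrow> (nat \<Rightarrow> nat) \<times> (nat \<Rightarrow> int)) monoid"
  where "wreath_product \<equiv> product_group {k. k dvd m} (\<lambda>k. sym_semidirect_cyclic (n k) k)"

lemma dvd_m_pos: "k dvd m \<Longrightarrow> 0 < k"
  using m_pos by (meson dvd_pos_nat)

lemma wreath_productD:
  assumes "F \<in> carrier wreath_product" "k dvd m"
  shows "fst (F k) permutes {1..n k}" "snd (F k) \<in> {1..n k} \<rightarrow>\<^sub>E {0..<int k}"
proof -
  have "F k \<in> carrier (sym_semidirect_cyclic (n k) k)"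
    using assms by auto
  then show "fst (F k) permutes {1..n k}" "snd (F k) \<in> {1..n k} \<rightarrow>\<^sub>E {0..<int k}"
    using dvd_m_pos[OF assms(2)]
    by (auto simp: carrier_sym_semidirect_cyclic carrier_integer_mod_group)
qed

lemma permutes_coord_index:
  assumes "F \<in> carrier wreath_product" "k dvd m" "i \<in> {1..n k}"
  shows "fst (F k) i \<in> {1..n k}"
  using wreath_productD(1)[OF assms(1,2)] assms(3) by (simp only: permutes_in_image)

text \<open>Justifies the \<open>THE\<close> in \<open>wreath_map\<close>: the point determines
  \<open>k\<close> and \<open>i\<close>, and it determines \<open>a\<close> modulo \<open>k\<close>,
  which is all that the image depends on.\<close>

lemma wreath_map_coord:
  assumes F: "F \<in> carrier wreath_product" and k: "k dvd m" and i: "i \<in> {1..n k}"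
  shows "wreath_map F (coord k i a) = coord k (fst (F k) i) (a + nat (snd (F k) i))"
proof -
  have "(THE y. \<exists>k' i' a'. k' dvd m \<and> i' \<in> {1..n k'} \<and> coord k i a = coord k' i' a' \<and>
    y = coord k' (fst (F k') i') (a' + nat (snd (F k') i'))) = coord k (fst (F k) i) (a + nat (snd (F k) i))"
  proof (rule the_equality)
    fix y
    assume "\<exists>k' i' a'. k' dvd m \<and> i' \<in> {1..n k'} \<and> coord k i a = coord k' i' a' \<and>
      y = coord k' (fst (F k') i') (a' + nat (snd (F k') i'))"
    then obtain a' where a: "a mod k = a' mod k" "y = coord k (fst (F k) i) (a' + nat (snd (F k) i))"
      using coord_eq_iff[OF k i] by blast
    then show "y = coord k (fst (F k) i) (a + nat (snd (F k) i))"
      using coord_eq_iff[OF k permutes_coord_index[OF F k i] k permutes_coord_index[OF F k i]]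
      by (metis mod_add_left_eq)
  qed (use k i in blast)
  then show ?thesis
    using coord_closed[OF k i] by (simp add: wreath_map_def)
qed

lemma wreath_map_in_centralizer:
  assumes F: "F \<in> carrier wreath_product"
  shows "wreath_map F \<in> carrier (bij_centralizer A \<phi>)"
proof -
  have ext: "wreath_map F \<in> A \<rightarrow>\<^sub>E A"
  proof
    fix x assume "x \<in> A"
    then show "wreath_map F x \<in> A"
      by (metis coordE wreath_map_coord[OF F] coord_closed permutes_coord_index[OF F])
  qed (simp add: wreath_map_def)
  have inj: "inj_on (wreath_map F) A"
  proof (rule inj_onI)
    fix x y assume xy: "x \<in> A" "y \<in> A" "wreath_map F x = wreath_map F y"
    obtain k i a where x: "k dvd m" "i \<in> {1..n k}" "x = coord k i a"
      using xy(1) by (rule coordE)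
    obtain k' i' a' where y: "k' dvd m" "i' \<in> {1..n k'}" "y = coord k' i' a'"
      using xy(2) by (rule coordE)
    have eq: "k = k'" "fst (F k) i = fst (F k) i'"
      "(a + nat (snd (F k) i)) mod k = (a' + nat (snd (F k) i')) mod k"
      using xy(3) coord_eq_iff[OF x(1) permutes_coord_index[OF F x(1,2)] y(1) permutes_coord_index[OF F y(1,2)]]
      unfolding x(3) y(3) wreath_map_coord[OF F x(1,2)] wreath_map_coord[OF F y(1,2)] by auto
    then have i: "i = i'"
      using permutes_inj[OF wreath_productD(1)[OF F x(1)]] by (simp add: inj_eq)
    then have "a mod k = a' mod k"
      using eq(3) unfolding i by (metis cong_def cong_add_rcancel_nat)
    then show "x = y"
      using coord_eq_iff[OF x(1,2) y(1,2)] eq i by (simp add: x(3) y(3))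
  qed
  have "bij_betw (wreath_map F) A A"
    using inj ext finite_A by (simp add: bij_betw_def endo_inj_surj image_subset_iff PiE_iff)
  moreover have "wreath_map F (\<phi> x) = \<phi> (wreath_map F x)" if "x \<in> A" for x
    using that
  proof (rule coordE)
    fix k i a assume x: "k dvd m" "i \<in> {1..n k}" "x = coord k i a"
    have s: "\<phi> (coord k j b) = coord k j (Suc b)" for j b
      using funpow_coord[of 1] by simp
    show ?thesis
      by (simp only: x(3) s wreath_map_coord[OF F x(1,2)] add_Suc)
  qed
  ultimately show ?thesis
    using ext by (simp add: bij_centralizer_def)
qed

lemma wreath_product_closed:
  assumes "F \<in> carrier wreath_product" "G \<in> carrier wreath_product"
  shows "F \<otimes>\<^bsub>wreath_product\<^esub> G \<in> carrier wreath_product"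
  using assms dvd_m_pos by (auto simp: PiE_iff intro!: sym_semidirect_cyclic_closed)

text \<open>\<open>G\<close> acts first and moves orbit \<open>i\<close> to orbit \<open>?j\<close>,
  so \<open>F\<close> then contributes its rotation at \<open>?j\<close>. This is exactly the
  reindexing that \<open>permute_coords\<close> performs in the semidirect product.\<close>

lemma wreath_map_mult:
  assumes F: "F \<in> carrier wreath_product" and G: "G \<in> carrier wreath_product"
  shows "wreath_map (F \<otimes>\<^bsub>wreath_product\<^esub> G) = compose A (wreath_map F) (wreath_map G)"
proof (rule extensionalityI[of _ A])
  fix x assume "x \<in> A"
  then obtain k i a where x: "k dvd m" "i \<in> {1..n k}" "x = coord k i a"
    by (rule coordE)
  let ?j = "fst (G k) i"
  let ?FG = "F \<otimes>\<^bsub>wreath_product\<^esub> G"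
  have j: "?j \<in> {1..n k}"
    using permutes_coord_index[OF G x(1,2)] .
  have FG: "fst (?FG k) i = fst (F k) ?j" "snd (?FG k) i = (snd (F k) ?j + snd (G k) i) mod int k"
    using x(1,2) mult_sym_semidirect_cyclic[where \<sigma> = "fst (F k)" and \<gamma> = "snd (F k)" and n = "n k" and k = k
        and \<tau> = "fst (G k)" and \<delta> = "snd (G k)"]
    by auto
  have "snd (F k) ?j \<ge> 0" "snd (G k) i \<ge> 0"
    using wreath_productD(2)[OF F x(1)] wreath_productD(2)[OF G x(1)] j x(2) by (auto simp: PiE_iff)
  then have nat: "nat (snd (?FG k) i) = (nat (snd (G k) i) + nat (snd (F k) ?j)) mod k"
    unfolding FG by (simp add: nat_mod_distrib nat_add_distrib add.commute)
  have "wreath_map ?FG x = coord k (fst (F k) ?j) (a + nat (snd (?FG k) i))"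
    unfolding x(3) wreath_map_coord[OF wreath_product_closed[OF F G] x(1,2)] FG(1) ..
  also have "\<dots> = coord k (fst (F k) ?j) (a + nat (snd (G k) i) + nat (snd (F k) ?j))"
    unfolding coord_eq_iff[OF x(1) permutes_coord_index[OF F x(1) j] x(1) permutes_coord_index[OF F x(1) j]] nat
    by (simp add: mod_add_right_eq add.assoc)
  also have "\<dots> = wreath_map F (wreath_map G x)"
    by (simp only: x(3) wreath_map_coord[OF G x(1,2)] wreath_map_coord[OF F x(1) j])
  finally show "wreath_map ?FG x = compose A (wreath_map F) (wreath_map G) x"
    using \<open>x \<in> A\<close> by (simp add: compose_def)
qed (simp_all add: wreath_map_def)

text \<open>The images of the base points (offset 0) reveal the permutation and the rotations modulo
  \<open>k\<close>. Rotations lie in \<open>{0..<int k}\<close>, so congruent ones are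
  equal.\<close>

lemma inj_wreath_map: "inj_on wreath_map (carrier wreath_product)"
proof (rule inj_onI)
  fix F G assume F: "F \<in> carrier wreath_product" and G: "G \<in> carrier wreath_product"
    and eq: "wreath_map F = wreath_map G"
  have "F k = G k" if k: "k dvd m" for k
  proof -
    have *: "fst (F k) i = fst (G k) i \<and> snd (F k) i = snd (G k) i" if i: "i \<in> {1..n k}" for i
    proof -
      have "coord k (fst (F k) i) (nat (snd (F k) i)) = coord k (fst (G k) i) (nat (snd (G k) i))"
        using wreath_map_coord[OF F k i, of 0] wreath_map_coord[OF G k i, of 0] eq by simp
      then have fst: "fst (F k) i = fst (G k) i"
        and snd: "nat (snd (F k) i) mod k = nat (snd (G k) i) mod k"
        using coord_eq_iff k permutes_coord_index[OF F k i] permutes_coord_index[OF G k i] by blast+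
      have "snd (F k) i \<in> {0..<int k}" "snd (G k) i \<in> {0..<int k}"
        using wreath_productD(2)[OF F k] wreath_productD(2)[OF G k] i by (auto simp: PiE_iff)
      then show ?thesis
        using fst snd by (auto simp: nat_less_iff)
    qed
    have "fst (F k) i = fst (G k) i" for i
      using * permutes_not_in[OF wreath_productD(1)[OF F k]]
        permutes_not_in[OF wreath_productD(1)[OF G k]]
      by (cases "i \<in> {1..n k}") (simp_all del: atLeastAtMost_iff)
    then have "fst (F k) = fst (G k)"
      by (rule ext)
    moreover have "snd (F k) = snd (G k)"
      using * wreath_productD(2)[OF F k] wreath_productD(2)[OF G k]
      by (intro PiE_ext) blast+
    ultimately show ?thesis
      by (rule prod_eqI)
  qed
  then show "F = G"
    using F G by (intro PiE_ext[of F "{k. k dvd m}"]) auto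
qed

text \<open>A map commuting with \<open>\<phi>\<close> is determined by its values at the base
  points. Such a value again has period \<open>k\<close>, so its coordinates supply the target orbit
  \<open>s k i\<close> and the rotation \<open>t k i\<close>.\<close>

lemma surj_wreath_map:
  assumes "f \<in> carrier (bij_centralizer A \<phi>)"
  shows "f \<in> wreath_map ` carrier wreath_product"
proof -
  have ext: "f \<in> A \<rightarrow>\<^sub>E A" and inj: "inj_on f A" and comm: "\<forall>x\<in>A. f (\<phi> x) = \<phi> (f x)"
    using assms by (auto simp: bij_centralizer_def bij_betw_def)
  have "\<exists>c. fst c \<in> {1..n k} \<and> f (base k i) = coord k (fst c) (snd c)"
    if "k dvd m" "i \<in> {1..n k}" for k i
  proof -
    have "f (base k i) \<in> A" "period \<phi> (f (base k i)) = k"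
      using ext base_closed[OF that] period_base[OF that] period_commute[OF comm inj] by auto
    then obtain j a where "j \<in> {1..n k}" "f (base k i) = coord k j a"
      using coord_exists by metis
    then show ?thesis
      by (intro exI[of _ "(j, a)"]) simp
  qed
  then have "\<exists>c. \<forall>k i. k dvd m \<longrightarrow> i \<in> {1..n k} \<longrightarrow>
      fst (c k i) \<in> {1..n k} \<and> f (base k i) = coord k (fst (c k i)) (snd (c k i))"
    by (intro choice allI) auto
  then obtain c where c: "\<forall>k i. k dvd m \<longrightarrow> i \<in> {1..n k} \<longrightarrow>
      fst (c k i) \<in> {1..n k} \<and> f (base k i) = coord k (fst (c k i)) (snd (c k i))"
    by blast
  define s t where "s = (\<lambda>k i. fst (c k i))" and "t = (\<lambda>k i. snd (c k i))"
  have st: "s k i \<in> {1..n k} \<and> f (base k i) = coord k (s k i) (t k i)"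
    if "k dvd m" "i \<in> {1..n k}" for k i
    using c that unfolding s_def t_def by blast
  have f: "f (coord k i a) = coord k (s k i) (a + t k i)" if "k dvd m" "i \<in> {1..n k}" for k i a
    using commute_funpow[OF comm base_closed[OF that]] st[OF that] funpow_coord
    by (simp add: coord_def[of k i])
  \<comment> \<open>To land in the carriers, the permutation is extended by the identity outside
    \<open>{1..n k}\<close> and the rotations are reduced modulo \<open>k\<close>.\<close>
  define F where "F = (\<lambda>k\<in>{k. k dvd m}.
    (\<lambda>i. if i \<in> {1..n k} then s k i else i, \<lambda>i\<in>{1..n k}. int (t k i mod k)))"
  have "F k \<in> carrier (sym_semidirect_cyclic (n k) k)" if k: "k dvd m" for k
  proof -
    have "inj_on (s k) {1..n k}"
    proof (rule inj_onI)
      fix i j assume ij: "i \<in> {1..n k}" "j \<in> {1..n k}" "s k i = s k j"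
      \<comment> \<open>The offsets are taken crosswise: both images lie on the same orbit with
        offset \<open>t k i + t k j\<close>.\<close>
      have "f (coord k i (t k j)) = f (coord k j (t k i))"
        using ij k by (simp add: f add.commute del: atLeastAtMost_iff)
      then have "coord k i (t k j) = coord k j (t k i)"
        using inj coord_closed k ij by (meson inj_onD)
      then show "i = j"
        using coord_eq_iff k ij by blast
    qed
    then have "bij_betw (s k) {1..n k} {1..n k}"
      using st[OF k] by (simp add: bij_betw_def endo_inj_surj image_subset_iff del: atLeastAtMost_iff)
    then have "bij_betw (\<lambda>i. if i \<in> {1..n k} then s k i else i) {1..n k} {1..n k}"
      using bij_betw_cong[of "{1..n k}" "s k" "\<lambda>i. if i \<in> {1..n k} then s k i else i"] by simp
    then have "(\<lambda>i. if i \<in> {1..n k} then s k i else i) permutes {1..n k}"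
      by (rule bij_imp_permutes) auto
    then show ?thesis
      using k dvd_m_pos[OF k] by (auto simp: F_def carrier_sym_semidirect_cyclic carrier_integer_mod_group)
  qed
  then have F: "F \<in> carrier wreath_product"
    by (auto simp: F_def)
  have "wreath_map F = f"
  proof (rule extensionalityI[of _ A])
    fix x assume "x \<in> A"
    then obtain k i a where x: "k dvd m" "i \<in> {1..n k}" "x = coord k i a"
      by (rule coordE)
    have "wreath_map F x = coord k (s k i) (a + t k i mod k)"
      unfolding x(3) wreath_map_coord[OF F x(1,2)] using x(1,2) by (simp add: F_def nat_mod_distrib)
    also have "\<dots> = f x"
      unfolding x(3) f[OF x(1,2)]
      using st[OF x(1,2)] coord_eq_iff[OF x(1) _ x(1)] by (simp add: mod_add_right_eq)
    finally show "wreath_map F x = f x" .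
  qed (use ext in \<open>auto simp: wreath_map_def PiE_iff\<close>)
  then show ?thesis
    using F by blast
qed

theorem bij_centralizer_iso_wreath_product: "bij_centralizer A \<phi> \<cong> wreath_product"
proof -
  have "wreath_map \<in> iso wreath_product (bij_centralizer A \<phi>)"
    unfolding iso_def hom_def bij_betw_def
    using wreath_map_in_centralizer surj_wreath_map inj_wreath_map wreath_map_mult
    by (auto simp: mult_bij_centralizer simp del: mult_product_group carrier_product_group)
  from iso_inv_into[OF this wreath_product_closed] show ?thesis
    by (auto simp: is_iso_def)
qed

end

subsection \<open>Powers in finite fields\<close>

text \<open>Induction on \<open>n\<close>; \<open>step\<close> is Pascal's rule, applied term by
  term.\<close>

lemma (in cring) binomial_expansion:
  fixes n :: nat
  assumes x: "x \<in> carrier R" and y: "y \<in> carrier R"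
  shows "(x \<oplus> y) [^] n = (\<Oplus>k\<in>{..n}. [(n choose k)] \<cdot> (x [^] k \<otimes> y [^] (n - k)))"
proof (induction n)
  case 0
  then show ?case
    by simp
next
  case (Suc n)
  let ?t = "\<lambda>n k. [((n choose k) :: nat)] \<cdot> (x [^] k \<otimes> y [^] (n - k))"
  have t: "?t j k \<in> carrier R" for j k
    using x y by simp
  have step: "?t (Suc n) (Suc k) = ?t n k \<otimes> x \<oplus> ?t n (Suc k) \<otimes> y" if "k \<le> n" for k
  proof -
    have "?t n k \<otimes> x = [(n choose k)] \<cdot> (x [^] Suc k \<otimes> y [^] (n - k))"
      using x y by (simp add: add_pow_ldistr add_pow_rdistr m_ac)
    \<comment> \<open>For \<open>k = n\<close> the coefficient is 0, so the truncated difference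
      \<open>n - Suc k\<close> does no harm.\<close>
    moreover have "?t n (Suc k) \<otimes> y = [(n choose Suc k)] \<cdot> (x [^] Suc k \<otimes> y [^] (n - k))"
    proof (cases "k = n")
      case False
      with that have "n - k = Suc (n - Suc k)"
        by simp
      then show ?thesis
        using x y by (simp add: add_pow_ldistr add_pow_rdistr m_assoc)
    qed (use x y in \<open>simp add: binomial_eq_0\<close>)
    ultimately show ?thesis
      using x y by (simp add: add.nat_pow_mult del: nat_pow_Suc)
  qed
  have "(x \<oplus> y) [^] Suc n = (\<Oplus>k\<in>{..n}. ?t n k) \<otimes> (x \<oplus> y)"
    using Suc by simp
  also have "\<dots> = (\<Oplus>k\<in>{..n}. ?t n k) \<otimes> x \<oplus> (\<Oplus>k\<in>{..n}. ?t n k) \<otimes> y"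
    using x y t by (simp add: r_distr)
  also have "\<dots> = (\<Oplus>k\<in>{..n}. ?t n k \<otimes> x) \<oplus> (\<Oplus>k\<in>{..n}. ?t n k \<otimes> y)"
    using x y t by (simp add: finsum_ldistr)
  \<comment> \<open>The added top term has coefficient \<open>n choose Suc n = 0\<close>; it makes
    room for shifting the index by one.\<close>
  also have "(\<Oplus>k\<in>{..n}. ?t n k \<otimes> y) = (\<Oplus>k\<in>{..Suc n}. ?t n k \<otimes> y)"
    using x y t by (subst finsum_Suc) (auto simp: binomial_eq_0)
  also have "\<dots> = (\<Oplus>k\<in>{..n}. ?t n (Suc k) \<otimes> y) \<oplus> ?t n 0 \<otimes> y"
    using x y t by (subst finsum_Suc2) auto
  also have "(\<Oplus>k\<in>{..n}. ?t n k \<otimes> x) \<oplus> ((\<Oplus>k\<in>{..n}. ?t n (Suc k) \<otimes> y) \<oplus> ?t n 0 \<otimes> y)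
    = (\<Oplus>k\<in>{..n}. ?t n k \<otimes> x \<oplus> ?t n (Suc k) \<otimes> y) \<oplus> ?t n 0 \<otimes> y"
    using x y t by (subst finsum_addf) (auto simp: a_assoc)
  also have "(\<Oplus>k\<in>{..n}. ?t n k \<otimes> x \<oplus> ?t n (Suc k) \<otimes> y) = (\<Oplus>k\<in>{..n}. ?t (Suc n) (Suc k))"
    using step t x y by (intro finsum_cong') auto
  also have "?t n 0 \<otimes> y = ?t (Suc n) 0"
    using x y by simp
  also have "(\<Oplus>k\<in>{..n}. ?t (Suc n) (Suc k)) \<oplus> ?t (Suc n) 0 = (\<Oplus>k\<in>{..Suc n}. ?t (Suc n) k)"
    using t by (subst finsum_Suc2) auto
  finally show ?case .
qed

text \<open>The prime \<open>p\<close> divides \<open>p choose k\<close> for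
  \<open>0 < k < p\<close>, so only the two outer terms of the binomial expansion survive.\<close>

lemma (in cring) add_nat_pow_prime:
  fixes p :: nat
  assumes "Factorial_Ring.prime p" and char: "[p] \<cdot> \<one> = \<zero>"
    and x: "x \<in> carrier R" and y: "y \<in> carrier R"
  shows "(x \<oplus> y) [^] p = x [^] p \<oplus> y [^] p"
proof -
  let ?t = "\<lambda>k. [((p choose k) :: nat)] \<cdot> (x [^] k \<otimes> y [^] (p - k))"
  \<comment> \<open>With \<open>r = p - 2\<close>, the indices \<open>Suc k\<close> for
    \<open>k \<le> r\<close> are exactly the middle ones, from 1 to \<open>p - 1\<close>.\<close>
  obtain r where r: "p = Suc (Suc r)"
    using prime_ge_2_nat[OF assms(1)] by (metis add_2_eq_Suc le_iff_add)
  have mid: "?t k = \<zero>" if "0 < k" "k < p" for k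
  proof -
    have "p dvd p choose k"
      using dvd_choose_prime[of k p] assms(1) that by simp
    then obtain c where c: "p choose k = p * c" ..
    let ?z = "x [^] k \<otimes> y [^] (p - k)"
    have "[p] \<cdot> ?z = [p] \<cdot> \<one> \<otimes> ?z"
      using x y by (simp add: add_pow_ldistr)
    also have "\<dots> = \<zero>"
      using char x y by simp
    finally show ?thesis
      using x y unfolding c by (simp add: add.nat_pow_pow[symmetric])
  qed
  have t: "?t k \<in> carrier R" for k
    using x y by simp
  have "(\<Oplus>k\<in>{..r}. ?t (Suc k)) = (\<Oplus>k\<in>{..r}. \<zero>)"
    using mid by (intro finsum_cong') (simp_all only: Pi_I zero_closed atMost_iff r less_Suc_eq_le zero_less_Suc Suc_le_mono)
  then have "(\<Oplus>k\<in>{..Suc r}. ?t k) = ?t 0"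
    using t by (subst finsum_Suc2) (auto simp: y)
  then have "(\<Oplus>k\<in>{..p}. ?t k) = ?t p \<oplus> ?t 0"
    unfolding r using t by (subst finsum_Suc) (auto simp: r)
  then show ?thesis
    using x y unfolding binomial_expansion[OF x y] by simp
qed

lemma (in cring) add_nat_pow_prime_power:
  fixes p :: nat
  assumes "Factorial_Ring.prime p" "[p] \<cdot> \<one> = \<zero>" "x \<in> carrier R" "y \<in> carrier R"
  shows "(x \<oplus> y) [^] (p ^ k) = x [^] (p ^ k) \<oplus> y [^] (p ^ k)"
proof (induction k)
  case (Suc k)
  then show ?case
    using assms(3,4) add_nat_pow_prime[OF assms(1,2) nat_pow_closed nat_pow_closed]
    unfolding power_Suc2 by (simp add: nat_pow_pow[symmetric])
qed (use assms in simp)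

text \<open>By Lagrange in the additive group, \<open>p ^ k\<close> times one vanishes. That
  multiple is the \<open>k\<close>-th power of \<open>[p] \<cdot> \<one>\<close>, and a domain has
  no nonzero nilpotents.\<close>

lemma (in domain) char_of_prime_power_order:
  assumes "card (carrier R) = p ^ k" "finite (carrier R)"
  shows "[p] \<cdot> \<one> = \<zero>"
proof -
  have "[(card (carrier R))] \<cdot> \<one> = \<zero>"
    using group.pow_order_eq_1[OF a_group, of \<one>] assms(2) by (simp add: order_def add_pow_def)
  moreover have "[(p ^ j)] \<cdot> \<one> = ([p] \<cdot> \<one>) [^] j" for j
  proof (induction j)
    case (Suc j)
    have "[(p ^ Suc j)] \<cdot> \<one> = [p] \<cdot> ([(p ^ j)] \<cdot> \<one>)"
      by (simp add: add.nat_pow_pow mult.commute)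
    also have "\<dots> = ([p] \<cdot> \<one>) [^] j \<otimes> ([p] \<cdot> \<one>)"
      using add_pow_rdistr[of "([p] \<cdot> \<one>) [^] j" \<one> p] by (simp add: Suc)
    finally show ?case
      by simp
  qed simp
  ultimately have *: "([p] \<cdot> \<one>) [^] k = \<zero>"
    using assms(1) by simp
  have "z = \<zero>" if "z \<in> carrier R" "z [^] j = \<zero>" for z and j :: nat
    using that by (induction j) (auto simp: integral_iff)
  from this[OF _ *] show ?thesis
    by simp
qed

text \<open>Lagrange in the multiplicative group, multiplied once more by \<open>x\<close> so that
  zero can be included.\<close>

lemma (in field) pow_card_carrier:
  assumes "finite (carrier R)" "x \<in> carrier R"
  shows "x [^] card (carrier R) = x"
proof (cases "x = \<zero>")
  case True
  have "card (carrier R) \<noteq> 0"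
    using assms by auto
  then show ?thesis
    using True by (simp add: nat_pow_zero)
next
  case False
  interpret G: group "Multiplicative_Group.mult_of R"
    by (rule field_mult_group)
  have "x [^]\<^bsub>Multiplicative_Group.mult_of R\<^esub> order (Multiplicative_Group.mult_of R) = \<one>\<^bsub>Multiplicative_Group.mult_of R\<^esub>"
    using G.pow_order_eq_1[of x] assms(2) False by simp
  then have *: "x [^] (card (carrier R) - 1) = \<one>"
    using assms(1) by (simp add: Multiplicative_Group.nat_pow_mult_of order_mult_of order_def)
  have "card (carrier R) > 0"
    using assms by (auto simp: card_gt_0_iff)
  then show ?thesis
    using * assms(2) nat_pow_Suc[of x "card (carrier R) - 1"] by simp
qed

lemma (in field) pow_card_subfield:
  assumes "subfield K R" "finite K" "x \<in> K"
  shows "x [^] card K = x"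
  using field.pow_card_carrier[OF subfield_iff(2)[OF assms(1)], of x] assms
  by (simp add: nat_pow_consistent[symmetric])

lemma power_minus_one_dvd:
  fixes q :: nat
  assumes "d dvd m" "q > 0"
  shows "q ^ d - 1 dvd q ^ m - 1"
proof -
  obtain c where c: "m = d * c"
    using assms(1) ..
  \<comment> \<open>Over the integers subtraction is not truncated; \<open>y - 1\<close> divides
    \<open>y ^ c - 1\<close>, taken at \<open>y = q ^ d\<close>.\<close>
  have "int (q ^ d) - 1 dvd int (q ^ d) ^ c - 1"
    by (simp add: power_diff_1_eq)
  then have "int (q ^ d - 1) dvd int (q ^ m - 1)"
    using assms(2) by (simp add: of_nat_diff c power_mult)
  then show ?thesis
    by (simp only: int_dvd_int_iff)
qed

text \<open>The degree bounds the number of roots from above. Conversely, if \<open>a\<close>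
  generates the multiplicative group, of order \<open>c * e\<close>, then the powers
  \<open>a [^] (c * i)\<close> with \<open>i < e\<close> are \<open>e\<close> distinct
  solutions.\<close>

lemma (in field) card_roots_of_unity:
  assumes fin: "finite (carrier R)" and e: "e dvd card (carrier R) - 1" "e > 0"
  shows "card {x \<in> carrier R. x [^] e = \<one>} = e"
proof (rule antisym)
  show "card {x \<in> carrier R. x [^] e = \<one>} \<le> e"
    using num_roots_le_deg[OF fin] e(2) by simp
next
  let ?N = "card (carrier R) - 1"
  obtain c where c: "?N = c * e"
    using e(1) by (metis dvd_div_mult_self)
  obtain a where a: "a \<in> carrier R - {\<zero>}" and gen: "carrier R - {\<zero>} = {a [^] i |i::nat. True}"
    using finite_field_mult_group_has_gen[OF fin] by (auto simp: Multiplicative_Group.nat_pow_mult_of)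
  have N: "a [^] ?N = \<one>"
  proof -
    interpret G: group "Multiplicative_Group.mult_of R"
      by (rule field_mult_group)
    show ?thesis
      using G.pow_order_eq_1[of a] a fin by (simp add: Multiplicative_Group.nat_pow_mult_of order_mult_of order_def)
  qed
  have cardN: "card (carrier R - {\<zero>}) = ?N"
    using fin by simp
  have Npos: "?N > 0"
    using a fin cardN by (metis card_gt_0_iff empty_iff finite_Diff)
  have pow_mod: "a [^] i = a [^] (i mod ?N)" for i
  proof -
    have "a [^] i = a [^] (?N * (i div ?N) + i mod ?N)"
      by simp
    also have "\<dots> = (a [^] ?N) [^] (i div ?N) \<otimes> a [^] (i mod ?N)"
      using a by (simp add: nat_pow_mult nat_pow_pow)
    finally show ?thesis
      using a N by simp
  qed
  \<comment> \<open>Exponents below \<open>?N\<close> already reach all \<open>?N\<close> nonzero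
    elements, so by counting these powers are distinct.\<close>
  have "carrier R - {\<zero>} = (\<lambda>i. a [^] i) ` {..<?N}"
    unfolding gen
  proof (intro equalityI subsetI)
    fix z assume "z \<in> {a [^] i |i::nat. True}"
    then obtain i :: nat where "z = a [^] i"
      by blast
    then show "z \<in> (\<lambda>i. a [^] i) ` {..<?N}"
      using pow_mod[of i] mod_less_divisor[OF Npos, of i] by blast
  qed blast
  then have inj: "inj_on (\<lambda>i. a [^] i) {..<?N}"
    using cardN by (intro eq_card_imp_inj_on) auto
  have "inj_on (\<lambda>i. a [^] (c * i)) {..<e}"
  proof (rule inj_onI)
    fix i j assume "i \<in> {..<e}" "j \<in> {..<e}" "a [^] (c * i) = a [^] (c * j)"
    then have "c * i = c * j"
      using inj Npos unfolding c by (auto dest: inj_onD)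
    then show "i = j"
      using Npos c by (metis mult_cancel1 mult_zero_left less_irrefl)
  qed
  moreover have "(\<lambda>i. a [^] (c * i)) ` {..<e} \<subseteq> {x \<in> carrier R. x [^] e = \<one>}"
  proof
    fix x assume "x \<in> (\<lambda>i. a [^] (c * i)) ` {..<e}"
    then obtain i where x: "x = a [^] (c * i)"
      by blast
    have "x [^] e = (a [^] ?N) [^] i"
      using a unfolding x c by (simp add: nat_pow_pow mult_ac)
    then show "x \<in> {x \<in> carrier R. x [^] e = \<one>}"
      using a N x by simp
  qed
  ultimately show "e \<le> card {x \<in> carrier R. x [^] e = \<one>}"
    using card_inj_on_le[of "\<lambda>i. a [^] (c * i)" "{..<e}"] fin by simp
qed

subsection \<open>Polynomials over finite fields\<close>

text \<open>Padding with leading zeros matches these polynomials with the coefficient lists of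
  length exactly \<open>n\<close>; \<open>normalize\<close> strips the padding.\<close>

lemma (in ring) card_polys_of_bounded_length:
  assumes "finite K" "\<zero> \<in> K"
  shows "finite {p \<in> carrier (K[X]). length p \<le> n}"
    and "card {p \<in> carrier (K[X]). length p \<le> n} = card K ^ n"
proof -
  let ?L = "{l. set l \<subseteq> K \<and> length l = n}" and ?P = "{p \<in> carrier (K[X]). length p \<le> n}"
  have inj: "inj_on normalize ?L"
    by (rule inj_onI) (metis (mono_tags) mem_Collect_eq normalize_trick)
  have "normalize ` ?L = ?P"
  proof (intro equalityI subsetI)
    fix p assume "p \<in> normalize ` ?L"
    then show "p \<in> ?P"
      using normalize_gives_polynomial normalize_length_le by (auto simp: univ_poly_carrier[symmetric])
  next
    fix p assume p: "p \<in> ?P"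
    then have *: "polynomial K p"
      by (simp add: univ_poly_carrier)
    have "p = normalize (replicate (n - length p) \<zero> @ p)"
      using normalize_polynomial[OF *] by (simp add: normalize_replicate_zero)
    moreover have "replicate (n - length p) \<zero> @ p \<in> ?L"
      using p assms(2) polynomial_incl[OF *] by auto
    ultimately show "p \<in> normalize ` ?L"
      by blast
  qed
  then show "finite ?P" "card ?P = card K ^ n"
    using inj finite_lists_length_eq[OF assms(1), of n] card_lists_length_eq[OF assms(1), of n]
      card_image[of normalize ?L] by (metis (no_types) finite_imageI, metis (no_types))
qed

section \<open>Zeros, interpolation and residue rings\<close>

lemma (in field) card_zeros_le_degree:
  assumes "p \<in> carrier (poly_ring R)" "p \<noteq> []"
  shows "card {x \<in> carrier R. eval p x = \<zero>} \<le> degree p"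
proof -
  have *: "{x \<in> carrier R. eval p x = \<zero>} = set_mset (roots p)"
    using roots_mem_iff_is_root[OF assms(1)] assms(2) by (auto simp: is_root_def)
  have "card (set_mset (roots p)) \<le> size (roots p)"
    by (metis mset_set_set_mset_msubset size_mset_mono size_mset_set)
  then show "card {x \<in> carrier R. eval p x = \<zero>} \<le> degree p"
    unfolding * using size_roots_le_degree[OF assms(1)] by simp
qed

lemma (in domain) eval_minus:
  assumes "subring K R" "p \<in> carrier (K[X])" "p' \<in> carrier (K[X])" "x \<in> carrier R"
  shows "eval (p \<ominus>\<^bsub>K[X]\<^esub> p') x = eval p x \<ominus> eval p' x"
proof -
  interpret h: ring_hom_ring "K[X]" R "\<lambda>p. eval p x"
    by (rule eval_ring_hom[OF assms(1,4)])
  show ?thesis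
    using assms(2,3) by (simp add: a_minus_def)
qed

lemma (in domain) eval_mult:
  assumes "subring K R" "p \<in> carrier (K[X])" "p' \<in> carrier (K[X])" "x \<in> carrier R"
  shows "eval (p \<otimes>\<^bsub>K[X]\<^esub> p') x = eval p x \<otimes> eval p' x"
proof -
  interpret h: ring_hom_ring "K[X]" R "\<lambda>p. eval p x"
    by (rule eval_ring_hom[OF assms(1,4)])
  show ?thesis
    using assms(2,3) by simp
qed

lemma (in domain) length_minus_poly_le:
  assumes "subring K R" "p \<in> carrier (K[X])" "p' \<in> carrier (K[X])"
  shows "length (p \<ominus>\<^bsub>K[X]\<^esub> p') \<le> max (length p) (length p')"
  using poly_add_length_le[of p "map (\<lambda>a. \<ominus> a) p'"] univ_poly_a_inv_def'[OF assms(1,3)]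
  by (simp add: a_minus_def univ_poly_add del: poly_add.simps)

text \<open>The difference vanishes on the whole field, which is too many zeros for its degree
  unless it is the zero polynomial.\<close>

lemma (in field) eval_inject:
  assumes fin: "finite (carrier R)"
    and p: "p \<in> carrier (poly_ring R)" "length p \<le> card (carrier R)"
    and p': "p' \<in> carrier (poly_ring R)" "length p' \<le> card (carrier R)"
    and eq: "\<And>x. x \<in> carrier R \<Longrightarrow> eval p x = eval p' x"
  shows "p = p'"
proof -
  interpret P: domain "poly_ring R"
    by (rule univ_poly_is_domain[OF carrier_is_subring])
  let ?d = "p \<ominus>\<^bsub>poly_ring R\<^esub> p'"
  have "eval ?d x = \<zero>" if "x \<in> carrier R" for x
    using that eval_minus[OF carrier_is_subring p(1) p'(1)] eq[OF that] eval_in_carrier[of p x]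
      eval_poly_in_carrier[OF carrier_is_subring, of p' x] p'(1)
    by (simp add: univ_poly_carrier)
  then have *: "{x \<in> carrier R. eval ?d x = \<zero>} = carrier R"
    by auto
  have "?d = []"
  proof (rule ccontr)
    assume "?d \<noteq> []"
    \<comment> \<open>\<open>length ?d > 0\<close> is recorded because \<open>degree\<close> is a
      truncated \<open>length - 1\<close>.\<close>
    then have "card (carrier R) \<le> degree ?d" "length ?d > 0"
      using card_zeros_le_degree[of ?d] p(1) p'(1) by (auto simp: *)
    moreover have "length ?d \<le> card (carrier R)"
      using length_minus_poly_le[OF carrier_is_subring p(1) p'(1)] p(2) p'(2) by simp
    ultimately show False
      by linarith
  qed
  then show ?thesis
    using p(1) p'(1) P.r_right_minus_eq by (simp add: univ_poly_zero)
qed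

text \<open>By counting: evaluation maps the polynomials of bounded length injectively into the
  self-maps of the field, and both sets have \<open>N ^ N\<close> elements for
  \<open>N = card (carrier R)\<close>.\<close>

lemma (in field) interpolation:
  assumes fin: "finite (carrier R)" and f: "f \<in> carrier R \<rightarrow> carrier R"
  shows "\<exists>p. p \<in> carrier (poly_ring R) \<and> length p \<le> card (carrier R) \<and>
    (\<forall>x\<in>carrier R. eval p x = f x)"
proof -
  let ?P = "{p \<in> carrier (poly_ring R). length p \<le> card (carrier R)}"
  let ?E = "\<lambda>p. \<lambda>x\<in>carrier R. eval p x"
  have "inj_on ?E ?P"
  proof (rule inj_onI)
    fix p p' assume "p \<in> ?P" "p' \<in> ?P" "?E p = ?E p'"
    then show "p = p'"
      using fin by (intro eval_inject) (simp_all, metis restrict_apply')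
  qed
  moreover have "?E ` ?P \<subseteq> carrier R \<rightarrow>\<^sub>E carrier R"
    using eval_poly_in_carrier[OF carrier_is_subring] by (auto simp: univ_poly_carrier)
  moreover have "card ?P = card (carrier R \<rightarrow>\<^sub>E carrier R)"
    using card_polys_of_bounded_length(2)[OF fin] fin by (simp add: card_funcsetE)
  ultimately have "?E ` ?P = carrier R \<rightarrow>\<^sub>E carrier R"
    using fin by (intro card_subset_eq) (simp_all add: finite_PiE card_image)
  moreover have "restrict f (carrier R) \<in> carrier R \<rightarrow>\<^sub>E carrier R"
    using f by auto
  ultimately have "restrict f (carrier R) \<in> ?E ` ?P"
    by simp
  then obtain p where p: "p \<in> ?P" "restrict f (carrier R) = ?E p"
    by (elim imageE)
  have "eval p x = f x" if "x \<in> carrier R" for x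
    using fun_cong[OF p(2), of x] that by simp
  then show ?thesis
    using p(1) by blast
qed

lemma (in field) poly_representation_unique:
  assumes fin: "finite (carrier R)" and f: "f \<in> carrier R \<rightarrow> carrier R"
  shows "\<exists>!p. p \<in> carrier (poly_ring R) \<and> degree p < card (carrier R) \<and>
    (\<forall>x\<in>carrier R. eval p x = f x)"
proof -
  \<comment> \<open>Positivity makes the degree bound equivalent to the length bound even for
    \<open>[]\<close>, whose degree is 0.\<close>
  have pos: "card (carrier R) > 0"
    using fin by (auto simp: card_gt_0_iff)
  then have *: "degree p < card (carrier R) \<longleftrightarrow> length p \<le> card (carrier R)" for p :: "'a list"
    by linarith
  show ?thesis
    unfolding * using interpolation[OF assms] eval_inject[OF fin] by (metis (no_types))
qed

lemma (in field) poly_representation_props: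
  assumes "finite (carrier R)" "f \<in> carrier R \<rightarrow> carrier R"
  shows "poly_representation R f \<in> carrier (poly_ring R)"
    and "degree (poly_representation R f) < card (carrier R)"
    and "x \<in> carrier R \<Longrightarrow> eval (poly_representation R f) x = f x"
  using theI'[OF poly_representation_unique[OF assms]] unfolding poly_representation_def by blast+

text \<open>Each residue class has a unique remainder modulo \<open>p\<close>, a polynomial of
  length at most \<open>degree p\<close>.\<close>

lemma (in field) card_rupture:
  assumes "subfield K R" "finite K" "p \<in> carrier (K[X])" "p \<noteq> []"
  shows "finite (carrier (Rupt K p))" "card (carrier (Rupt K p)) = card K ^ degree p"
proof -
  have z: "\<zero> \<in> K"
    using subringE(2)[OF subfieldE(1)[OF assms(1)]] .
  let ?P = "{q \<in> carrier (K[X]). length q \<le> degree p}"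
  have img: "rupture_surj K p ` ?P = carrier (Rupt K p)"
    and inj: "inj_on (rupture_surj K p) ?P"
    using rupture_carrier_as_pmod_image[OF assms(1,3)] rupture_surj_inj_on[OF assms(1,3)]
    unfolding pmod_image_characterization[OF assms(1,3,4)] by blast+
  show "finite (carrier (Rupt K p))"
    using card_polys_of_bounded_length(1)[OF assms(2) z] img by (metis (no_types) finite_imageI)
  show "card (carrier (Rupt K p)) = card K ^ degree p"
    using card_polys_of_bounded_length(2)[OF assms(2) z, of "degree p"] card_image[OF inj] img by simp
qed

subsection \<open>The Frobenius automorphism\<close>

locale finite_field_power = field R for R (structure) +
  fixes q m :: nat
  assumes primepow_q: "primepow q" and m_ge_1: "m \<ge> 1"
    and finite_R: "finite (carrier R)" and card_R: "card (carrier R) = q ^ m"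
begin

definition frob :: "'a \<Rightarrow> 'a"
  where "frob x = x [^] q"

lemma q_gt_1: "q > 1"
  using primepow_gt_Suc_0[OF primepow_q] by simp

lemma pow_q_add:
  assumes "x \<in> carrier R" "y \<in> carrier R"
  shows "(x \<oplus> y) [^] (q ^ d) = x [^] (q ^ d) \<oplus> y [^] (q ^ d)"
proof -
  obtain p k where p: "Factorial_Ring.prime p" and q: "q = p ^ k"
    using primepow_q by (auto simp: primepow_def)
  have "[p] \<cdot> \<one> = \<zero>"
    using char_of_prime_power_order[of p "k * m"] card_R finite_R by (simp add: q power_mult)
  then show ?thesis
    using add_nat_pow_prime_power[OF p _ assms, of "k * d"] by (simp add: q power_mult)
qed

lemma funpow_frob: "x \<in> carrier R \<Longrightarrow> (frob ^^ i) x = x [^] (q ^ i)"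
  by (induction i) (simp_all add: frob_def nat_pow_pow mult.commute)

lemma frob_hom: "ring_hom_ring R R frob"
proof (rule ring_hom_ringI)
  show "frob (x \<oplus> y) = frob x \<oplus> frob y" if "x \<in> carrier R" "y \<in> carrier R" for x y
    using pow_q_add[OF that, of 1] by (simp add: frob_def)
qed (auto simp: frob_def ring_axioms nat_pow_distrib)

lemma pow_card: "x \<in> carrier R \<Longrightarrow> x [^] (q ^ m) = x"
  using pow_card_carrier[OF finite_R] card_R by simp

sublocale periodic_action "carrier R" frob m
proof
  show "(frob ^^ m) x = x" if "x \<in> carrier R" for x
    using that pow_card funpow_frob by simp
qed (use finite_R m_ge_1 in \<open>auto simp: frob_def\<close>)

lemma inj_frob: "inj_on frob (carrier R)"
  using funpow_inj[where a = 1] by (auto intro: inj_onI)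

lemma frob_surj: "frob ` carrier R = carrier R"
  using inj_frob finite_R closed by (intro endo_inj_surj) auto

section \<open>Subfields as fixed sets of powers of Frobenius\<close>

definition fixed :: "nat \<Rightarrow> 'a set"
  where "fixed d = {x \<in> carrier R. x [^] (q ^ d) = x}"

lemma fixed_iff_period_dvd: "x \<in> carrier R \<Longrightarrow> x \<in> fixed d \<longleftrightarrow> period frob x dvd d"
  using funpow_id_iff funpow_frob by (simp add: fixed_def)

lemma subfield_fixed: "subfield (fixed d) R"
proof (rule subfieldI')
  have qd: "q ^ d > 0"
    using q_gt_1 by simp
  show "subring (fixed d) R"
  proof (rule subringI)
    fix x assume x: "x \<in> fixed d"
    then have x': "x \<in> carrier R" "x [^] (q ^ d) = x"
      by (auto simp: fixed_def)
    \<comment> \<open>Additivity of the power map, applied to \<open>x \<oplus> \<ominus> x\<close>,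
      handles even and odd \<open>q\<close> alike.\<close>
    have "\<zero> = (x \<oplus> \<ominus> x) [^] (q ^ d)"
      using x' qd by (simp add: r_neg nat_pow_zero)
    also have "\<dots> = x \<oplus> (\<ominus> x) [^] (q ^ d)"
      using x' by (simp add: pow_q_add)
    finally have "(\<ominus> x) [^] (q ^ d) = \<ominus> x"
      using x' by (metis a_inv_closed a_comm minus_equality nat_pow_closed)
    then show "\<ominus> x \<in> fixed d"
      using x' by (simp add: fixed_def)
  qed (auto simp: fixed_def nat_pow_distrib pow_q_add)
  show "inv x \<in> fixed d" if "x \<in> fixed d - {\<zero>}" for x
  proof -
    have x: "x \<in> Units R" "x [^] (q ^ d) = x"
      using that by (auto simp: fixed_def field_Units)
    have "(inv x) [^] (q ^ d) \<otimes> x [^] (q ^ d) = \<one>"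
      using nat_pow_distrib[of "inv x" x "q ^ d"] x(1) by (simp add: Units_closed)
    then have "inv x = (inv x) [^] (q ^ d)"
      using x by (intro inv_char) (simp_all add: m_comm Units_closed)
    then show ?thesis
      using x(1) by (simp add: fixed_def)
  qed
qed

lemma finite_fixed: "finite (fixed d)"
  using finite_R by (auto simp: fixed_def)

text \<open>Apart from zero, these are the roots of unity for the exponent \<open>q ^ d - 1\<close>,
  which divides \<open>q ^ m - 1\<close> because \<open>d dvd m\<close>.\<close>

lemma card_fixed:
  assumes "d dvd m"
  shows "card (fixed d) = q ^ d"
proof -
  have d: "d > 0"
    using assms m_ge_1 by (meson dvd_pos_nat less_le_trans zero_less_one)
  have qd: "q ^ d > 1"
    using q_gt_1 d by (rule one_less_power)
  let ?U = "{x \<in> carrier R. x [^] (q ^ d - 1) = \<one>}"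
  have iff: "x [^] (q ^ d) = x \<longleftrightarrow> x [^] (q ^ d - 1) = \<one>" if "x \<in> carrier R" "x \<noteq> \<zero>" for x
  proof -
    have "Suc (q ^ d - 1) = q ^ d"
      using qd by simp
    then have "x [^] (q ^ d) = x [^] (q ^ d - 1) \<otimes> x"
      by (metis nat_pow_Suc)
    then show ?thesis
      using that by (metis l_one m_rcancel nat_pow_closed one_closed)
  qed
  have zero: "\<zero> [^] (q ^ d) = \<zero>" "\<zero> [^] (q ^ d - 1) \<noteq> \<one>"
    using qd q_gt_1 by (simp_all add: nat_pow_zero)
  have "fixed d = insert \<zero> ?U" "\<zero> \<notin> ?U"
    using iff zero by (auto simp: fixed_def)
  moreover have "card ?U = q ^ d - 1"
  proof (rule card_roots_of_unity[OF finite_R])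
    show "q ^ d - 1 dvd card (carrier R) - 1"
      unfolding card_R using power_minus_one_dvd[OF assms] q_gt_1 by simp
  qed (use qd in simp)
  ultimately show ?thesis
    using finite_R qd by simp
qed

text \<open>Every element of a subfield with \<open>q ^ d\<close> elements equals its own power with
  exponent \<open>q ^ d\<close>, so that subfield lies in \<open>fixed d\<close>; equal size forces
  equality, as the \<open>THE\<close> demands.\<close>

lemma subfield_of_card_eq:
  assumes "d dvd m"
  shows "subfield_of_card R (q ^ d) = fixed d"
  unfolding subfield_of_card_def
proof (rule the_equality)
  show "subfield (fixed d) R \<and> card (fixed d) = q ^ d"
    using subfield_fixed card_fixed[OF assms] by blast
next
  fix K assume K: "subfield K R \<and> card K = q ^ d"
  have sub: "K \<subseteq> carrier R"
    using K subfieldE(3) by blast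
  then have "finite K"
    using finite_R finite_subset by blast
  then have "K \<subseteq> fixed d"
    using K sub pow_card_subfield[of K] by (auto simp: fixed_def subset_iff)
  then show "K = fixed d"
    using K card_fixed[OF assms] finite_fixed by (metis card_subset_eq)
qed

lemma subfield_of_card_q: "subfield_of_card R q = fixed 1"
  using subfield_of_card_eq[of 1] by simp

lemma fixed_1_iff: "x \<in> fixed 1 \<longleftrightarrow> x \<in> carrier R \<and> frob x = x"
  by (simp add: fixed_def frob_def)

lemma card_fixed_1: "card (fixed 1) = q"
  using card_fixed[of 1] by simp

section \<open>Frobenius on coefficients and the units of the monoid\<close>

lemma map_frob_closed:
  assumes "p \<in> carrier (poly_ring R)"
  shows "map frob p \<in> carrier (poly_ring R)"
proof (cases p)
  case (Cons a p')
  then have a: "a \<in> carrier R" "a \<noteq> \<zero>" and p': "set p' \<subseteq> carrier R"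
    using assms by (auto simp: univ_poly_carrier[symmetric] polynomial_def)
  have "frob \<zero> = \<zero>"
    using q_gt_1 by (simp add: frob_def nat_pow_zero)
  then have "frob a \<noteq> \<zero>"
    using inj_frob a by (metis inj_onD zero_closed)
  then show ?thesis
    using a p' closed by (auto simp: Cons univ_poly_carrier[symmetric] polynomial_def)
qed (simp add: univ_poly_zero_closed)

lemma eval_map_frob:
  assumes "p \<in> carrier (poly_ring R)" "x \<in> carrier R"
  shows "eval (map frob p) (frob x) = frob (eval p x)"
  using ring_hom_ring.eval_hom[OF frob_hom carrier_is_subring assms(2,1)] by simp

text \<open>\<open>map frob ?p\<close> takes the value \<open>frob (f x)\<close> at
  \<open>frob x\<close>, where \<open>?p\<close> takes the value \<open>f (frob x)\<close>. As every
  point has the form \<open>frob x\<close>, uniqueness of the polynomial turns agreement of values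
  into agreement of coefficients.\<close>

lemma coeffs_fixed_iff:
  assumes "f \<in> carrier R \<rightarrow> carrier R"
  shows "set (poly_representation R f) \<subseteq> fixed 1 \<longleftrightarrow> (\<forall>x\<in>carrier R. f (frob x) = frob (f x))"
proof -
  let ?p = "poly_representation R f"
  have p: "?p \<in> carrier (poly_ring R)" and eval: "\<And>x. x \<in> carrier R \<Longrightarrow> eval ?p x = f x"
    using poly_representation_props[OF finite_R assms] by blast+
  have len: "length ?p \<le> card (carrier R)"
    using poly_representation_props(2)[OF finite_R assms] by linarith
  have "set ?p \<subseteq> carrier R"
    using p by (auto simp: univ_poly_carrier[symmetric] polynomial_def)
  then have "set ?p \<subseteq> fixed 1 \<longleftrightarrow> map frob ?p = ?p"
    by (auto simp: fixed_1_iff[unfolded One_nat_def] map_idI subset_iff list_eq_iff_nth_eq in_set_conv_nth)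
  also have "\<dots> \<longleftrightarrow> (\<forall>x\<in>carrier R. f (frob x) = frob (f x))"
  proof
    assume "map frob ?p = ?p"
    then show "\<forall>x\<in>carrier R. f (frob x) = frob (f x)"
      using eval_map_frob[OF p] eval closed by metis
  next
    assume comm: "\<forall>x\<in>carrier R. f (frob x) = frob (f x)"
    show "map frob ?p = ?p"
    proof (rule eval_inject[OF finite_R map_frob_closed[OF p] _ p len])
      fix y assume "y \<in> carrier R"
      then obtain x where x: "x \<in> carrier R" "y = frob x"
        using frob_surj by blast
      then show "eval (map frob ?p) y = eval ?p y"
        using comm eval eval_map_frob[OF p x(1)] closed by simp
    qed (use len in simp)
  qed
  finally show ?thesis .
qed

text \<open>Such a map preserves periods, and membership in \<open>fixed d\<close> depends only on
  the period.\<close>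

lemma subfield_preserving_commute:
  assumes f: "bij_betw f (carrier R) (carrier R)" and comm: "\<forall>x\<in>carrier R. f (frob x) = frob (f x)"
  shows "subfield_preserving R q m f"
proof -
  have fixed: "f x \<in> fixed d \<longleftrightarrow> x \<in> fixed d" if "x \<in> carrier R" for x d
    using period_commute[OF comm bij_betw_imp_inj_on[OF f] that] that bij_betw_apply[OF f that]
    by (simp add: fixed_iff_period_dvd)
  have "fixed d \<subseteq> carrier R" for d
    by (auto simp: fixed_def)
  then have sub: "f ` fixed d \<subseteq> fixed d" "f ` (fixed d - fixed s) \<subseteq> fixed d - fixed s" for d s
    using fixed by blast+
  then show ?thesis
    unfolding subfield_preserving_def
    using subfield_of_card_q subfield_of_card_eq by simp
qed

text \<open>A two-sided inverse makes a unit bijective. Conversely, the inverse of a bijection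
  commuting with \<open>frob\<close> commutes as well, so it is again subfield preserving and lies
  in the monoid.\<close>

lemma units_of_T_monoid: "units_of (T_monoid R q m) = bij_centralizer (carrier R) frob"
proof -
  let ?T = "T_monoid R q m"
  have carrier: "carrier ?T = {f \<in> carrier R \<rightarrow>\<^sub>E carrier R. subfield_preserving R q m f \<and>
      (\<forall>x\<in>carrier R. f (frob x) = frob (f x))}"
    using coeffs_fixed_iff by (auto simp: T_monoid_def subfield_of_card_q PiE_iff)
  have mult: "f \<otimes>\<^bsub>?T\<^esub> g = compose (carrier R) f g" and one: "\<one>\<^bsub>?T\<^esub> = (\<lambda>x\<in>carrier R. x)" for f g
    by (simp_all add: T_monoid_def)
  have "Units ?T = {f \<in> carrier R \<rightarrow>\<^sub>E carrier R. bij_betw f (carrier R) (carrier R) \<and>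
      (\<forall>x\<in>carrier R. f (frob x) = frob (f x))}" (is "_ = ?C")
  proof (intro equalityI subsetI)
    fix f assume "f \<in> Units ?T"
    then obtain g where f: "f \<in> carrier ?T" and g: "g \<in> carrier ?T"
      and gf: "compose (carrier R) g f = (\<lambda>x\<in>carrier R. x)" and fg: "compose (carrier R) f g = (\<lambda>x\<in>carrier R. x)"
      by (auto simp: Units_def T_monoid_def)
    have "bij_betw f (carrier R) (carrier R)"
    proof (rule bij_betw_byWitness[where f' = g])
      show "\<forall>x\<in>carrier R. g (f x) = x" "\<forall>x\<in>carrier R. f (g x) = x"
        using fun_cong[OF gf] fun_cong[OF fg] by (metis compose_eq restrict_apply')+
      show "f ` carrier R \<subseteq> carrier R" "g ` carrier R \<subseteq> carrier R"
        using f g by (auto simp: carrier)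
    qed
    then show "f \<in> ?C"
      using f by (simp add: carrier)
  next
    fix f assume f: "f \<in> ?C"
    \<comment> \<open>The restriction makes the inverse extensional, as the carrier
      requires.\<close>
    let ?g = "\<lambda>x\<in>carrier R. inv_into (carrier R) f x"
    have bij: "bij_betw f (carrier R) (carrier R)" and comm: "\<And>x. x \<in> carrier R \<Longrightarrow> f (frob x) = frob (f x)"
      using f by auto
    have f_g: "f (?g x) = x" and g_f: "?g (f x) = x" and g_closed: "?g x \<in> carrier R" and f_closed: "f x \<in> carrier R"
      if "x \<in> carrier R" for x
      using that bij bij_betw_apply[OF bij] bij_betw_apply[OF bij_betw_inv_into[OF bij]]
      by (auto simp: bij_betw_inv_into_right bij_betw_inv_into_left)
    have "?g (frob x) = frob (?g x)" if "x \<in> carrier R" for x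
      using comm[OF g_closed[OF that]] f_g[OF that] g_f[of "frob (?g x)"] g_closed[OF that] closed
      by metis
    moreover have "bij_betw ?g (carrier R) (carrier R)"
      using bij_betw_inv_into[OF bij] by (rule bij_betw_cong[THEN iffD2, rotated]) simp
    ultimately have "?g \<in> carrier ?T"
      using subfield_preserving_commute[of ?g] g_closed unfolding carrier by auto
    moreover have "f \<in> carrier ?T"
      using f subfield_preserving_commute[of f] by (auto simp: carrier)
    moreover have "compose (carrier R) ?g f = (\<lambda>x\<in>carrier R. x)" "compose (carrier R) f ?g = (\<lambda>x\<in>carrier R. x)"
      using g_f f_g by (auto simp: compose_def simp del: restrict_apply intro!: restrict_ext)
    ultimately show "f \<in> Units ?T"
      unfolding Units_def mem_Collect_eq mult one by blast
  qed
  then show ?thesis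
    by (simp add: units_of_def bij_centralizer_def T_monoid_def)
qed

end

subsection \<open>Minimal polynomials\<close>

text \<open>Used in the residue field of an irreducible \<open>p\<close>, to pass from exponent
  \<open>q ^ degree p\<close> to exponent \<open>q ^ m\<close>.\<close>

lemma (in monoid) nat_pow_power_fixed:
  fixes N c :: nat
  assumes "y \<in> carrier G" "y [^] N = y"
  shows "y [^] (N ^ c) = y"
proof (induction c)
  case (Suc c)
  have "y [^] (N ^ Suc c) = (y [^] N) [^] (N ^ c)"
    using assms(1) by (simp add: nat_pow_pow)
  then show ?case
    using Suc assms(2) by simp
qed (use assms in simp)

context finite_field_power
begin

abbreviation minpoly :: "'a \<Rightarrow> 'a list"
  where "minpoly \<equiv> Irr (fixed 1)"

lemma subring_fixed: "subring (fixed d) R"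
  using subfieldE(1)[OF subfield_fixed] .

lemma zero_in_fixed: "\<zero> \<in> fixed d"
  using subringE(2)[OF subring_fixed] .

lemma fixed_poly_carrier:
  assumes "p \<in> carrier ((fixed d)[X])"
  shows "p \<in> carrier (poly_ring R)"
  using carrier_polynomial_shell[OF subring_fixed assms] .

lemma eval_fixed_poly_frob:
  assumes p: "p \<in> carrier ((fixed 1)[X])" and x: "x \<in> carrier R"
  shows "eval p (frob x) = frob (eval p x)"
proof -
  have "set p \<subseteq> fixed 1"
    using p polynomial_incl by (simp add: univ_poly_carrier[symmetric])
  then have "map frob p = p"
    using fixed_1_iff by (intro map_idI) blast
  then show ?thesis
    using eval_map_frob[OF fixed_poly_carrier[OF p] x] by simp
qed

lemma eval_fixed_poly_funpow:
  assumes "p \<in> carrier ((fixed 1)[X])" "x \<in> carrier R"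
  shows "eval p ((frob ^^ i) x) = (frob ^^ i) (eval p x)"
  using assms commute_funpow[of "eval p" x i] eval_fixed_poly_frob by blast

lemma eval_in_carrier_poly:
  assumes "p \<in> carrier (poly_ring R)" "x \<in> carrier R"
  shows "eval p x \<in> carrier R"
  using eval_poly_in_carrier[OF carrier_is_subring] assms by (simp add: univ_poly_carrier)

text \<open>Length \<open>Suc m\<close> allows \<open>q ^ Suc m\<close> polynomials, more than the
  \<open>q ^ m\<close> available values, so evaluation at \<open>x\<close> cannot be
  injective.\<close>

lemma algebraic_fixed:
  assumes "x \<in> carrier R"
  shows "(algebraic over (fixed 1)) x"
  unfolding over_def
proof
  assume "transcendental (fixed 1) x"
  then have "inj_on (\<lambda>p. eval p x) {p \<in> carrier ((fixed 1)[X]). length p \<le> Suc m}"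
    by (auto simp: transcendental_def intro: inj_on_subset)
  moreover have "(\<lambda>p. eval p x) ` {p \<in> carrier ((fixed 1)[X]). length p \<le> Suc m} \<subseteq> carrier R"
    using eval_in_carrier_poly[OF fixed_poly_carrier assms] by blast
  ultimately have "card {p \<in> carrier ((fixed 1)[X]). length p \<le> Suc m} \<le> card (carrier R)"
    using finite_R by (rule card_inj_on_le)
  then have "q ^ Suc m \<le> q ^ m"
    unfolding card_polys_of_bounded_length(2)[OF finite_fixed zero_in_fixed] card_R card_fixed_1 .
  then show False
    using q_gt_1 by simp
qed

lemmas minpoly_props = IrrE[OF subfield_fixed _ algebraic_fixed]

lemma minpoly_unique:
  assumes "x \<in> carrier R" "p \<in> carrier ((fixed 1)[X])" "pirreducible (fixed 1) p"
    "eval p x = \<zero>" "lead_coeff p = \<one>"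
  shows "p = minpoly x"
  using minimal_polynomial_is_unique[OF subfield_fixed assms(1) algebraic_fixed[OF assms(1)]]
    minpoly_props[OF assms(1) assms(1)] assms by blast

text \<open>Evaluation at \<open>x\<close> is injective on polynomials of length at most
  \<open>?d\<close>, and its values lie in \<open>fixed ?j\<close>. Hence
  \<open>q ^ ?d \<le> q ^ ?j\<close>.\<close>

lemma degree_minpoly_le:
  assumes x: "x \<in> carrier R"
  shows "degree (minpoly x) \<le> period frob x"
proof -
  let ?d = "degree (minpoly x)" and ?j = "period frob x"
  let ?P = "{p \<in> carrier ((fixed 1)[X]). length p \<le> ?d}"
  interpret P: domain "(fixed 1)[X]"
    by (rule univ_poly_is_domain[OF subring_fixed])
  have d: "?d \<ge> 1"
    using pirreducible_degree[OF subfield_fixed] minpoly_props[OF x x] by blast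
  have "inj_on (\<lambda>p. eval p x) ?P"
  proof (rule inj_onI)
    fix p p' assume p: "p \<in> ?P" and p': "p' \<in> ?P" and eq: "eval p x = eval p' x"
    let ?r = "p \<ominus>\<^bsub>(fixed 1)[X]\<^esub> p'"
    have r: "?r \<in> carrier ((fixed 1)[X])"
      using p p' by blast
    have "eval p' x \<in> carrier R"
      using eval_in_carrier_poly[OF fixed_poly_carrier x] p' by blast
    moreover have "eval ?r x = eval p x \<ominus> eval p' x"
      using eval_minus[OF subring_fixed _ _ x] p p' by blast
    ultimately have "eval ?r x = \<zero>"
      by (simp add: eq)
    then have dvd: "minpoly x pdivides ?r"
      using Irr_minimal[OF subfield_fixed x algebraic_fixed[OF x] r] by blast
    have "?r = []"
    proof (rule ccontr)
      assume nz: "?r \<noteq> []"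
      have "?d \<le> degree ?r"
        using pdivides_imp_degree_le[OF subring_fixed minpoly_props(1)[OF x x] r nz dvd] .
      moreover have "length ?r \<le> max (length p) (length p')"
        using length_minus_poly_le[OF subring_fixed] p p' by blast
      moreover have "length p \<le> ?d" "length p' \<le> ?d"
        using p p' by blast+
      moreover have "length ?r > 0"
        using nz by simp
      ultimately show False
        using d by linarith
    qed
    then show "p = p'"
      using P.r_right_minus_eq[of p p'] p p' by (simp add: univ_poly_zero)
  qed
  \<comment> \<open>Frobenius commutes with evaluation of \<open>p\<close>, so a power of it that
    fixes \<open>x\<close> also fixes the value at \<open>x\<close>.\<close>
  moreover have "(\<lambda>p. eval p x) ` ?P \<subseteq> fixed ?j"
  proof
    fix y assume "y \<in> (\<lambda>p. eval p x) ` ?P"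
    then obtain p where p: "p \<in> carrier ((fixed 1)[X])" "y = eval p x"
      by blast
    then have y: "y \<in> carrier R"
      using eval_in_carrier_poly[OF fixed_poly_carrier x] by blast
    have "(frob ^^ ?j) y = y"
      using eval_fixed_poly_funpow[OF p(1) x, of ?j] funpow_period[OF x] p(2) by simp
    then show "y \<in> fixed ?j"
      using y funpow_frob by (simp add: fixed_def)
  qed
  ultimately have "card ?P \<le> card (fixed ?j)"
    using finite_fixed by (rule card_inj_on_le)
  then have "q ^ ?d \<le> q ^ ?j"
    unfolding card_polys_of_bounded_length(2)[OF finite_fixed zero_in_fixed] card_fixed_1
      card_fixed[OF period_dvd[OF x]] .
  then show ?thesis
    using q_gt_1 by simp
qed

text \<open>The orbit of \<open>x\<close> consists of zeros, giving the chain period \<le> number of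
  zeros \<le> degree \<le> period, in which equality must hold throughout.\<close>

lemma degree_minpoly: "x \<in> carrier R \<Longrightarrow> degree (minpoly x) = period frob x"
  and zeros_minpoly: "x \<in> carrier R \<Longrightarrow>
    {y \<in> carrier R. eval (minpoly x) y = \<zero>} = (\<lambda>i. (frob ^^ i) x) ` {..<period frob x}"
proof -
  assume x: "x \<in> carrier R"
  let ?Z = "{y \<in> carrier R. eval (minpoly x) y = \<zero>}"
  let ?I = "(\<lambda>i. (frob ^^ i) x) ` {..<period frob x}"
  have p: "minpoly x \<in> carrier (poly_ring R)" "minpoly x \<noteq> []"
    using fixed_poly_carrier minpoly_props(1)[OF x x]
      pirreducibleE(1)[OF subring_fixed minpoly_props(1,2)[OF x x]] by blast+
  have "inj_on (\<lambda>i. (frob ^^ i) x) {..<period frob x}"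
    by (rule inj_onI) (simp add: funpow_eq_iff[OF x])
  then have card_I: "card ?I = period frob x"
    by (simp add: card_image)
  have "frob \<zero> = \<zero>"
    using zero_in_fixed[of 1] by (simp only: fixed_1_iff)
  then have "(frob ^^ i) \<zero> = \<zero>" for i
    by (induction i) auto
  then have sub: "?I \<subseteq> ?Z"
    using eval_fixed_poly_funpow[OF minpoly_props(1)[OF x x] x] minpoly_props(4)[OF x x]
      funpow_closed[OF x] by auto
  have fin: "finite ?Z"
    using finite_R by simp
  have "card ?Z \<le> degree (minpoly x)"
    using card_zeros_le_degree[OF p] .
  then have "card ?I = card ?Z" and deg: "degree (minpoly x) = period frob x"
    using degree_minpoly_le[OF x] card_mono[OF fin sub] card_I by linarith+
  then show "?Z = ?I"
    using card_subset_eq[OF fin sub] by simp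
  show "degree (minpoly x) = period frob x"
    by (rule deg)
qed

text \<open>The zeros of \<open>minpoly x\<close> are exactly the orbit of \<open>x\<close>, so
  minimal polynomials can serve as orbit labels.\<close>

lemma minpoly_eq_iff:
  assumes x: "x \<in> carrier R" and y: "y \<in> carrier R"
  shows "minpoly x = minpoly y \<longleftrightarrow> (\<exists>i. y = (frob ^^ i) x)"
proof
  assume "minpoly x = minpoly y"
  then have "y \<in> {y \<in> carrier R. eval (minpoly x) y = \<zero>}"
    using minpoly_props(4)[OF y y] y by simp
  then show "\<exists>i. y = (frob ^^ i) x"
    unfolding zeros_minpoly[OF x] by blast
next
  assume "\<exists>i. y = (frob ^^ i) x"
  then obtain i where i: "y = (frob ^^ i) x" ..
  let ?i = "i mod period frob x"
  have "y = (frob ^^ ?i) x" "?i < period frob x"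
    using i funpow_mod_period[OF x] period_pos[OF x] by auto
  then have "y \<in> {y \<in> carrier R. eval (minpoly x) y = \<zero>}"
    unfolding zeros_minpoly[OF x] by blast
  then show "minpoly x = minpoly y"
    using minpoly_unique[OF y] minpoly_props[OF x x] by blast
qed

text \<open>
  The residue field \<open>L\<close> of \<open>p\<close> has \<open>q ^ degree p\<close> elements, so the class of \<open>X\<close> satisfies
  \<open>X ^ (q ^ m) = X\<close> and \<open>p\<close> divides \<open>X ^ (q ^ m) - X\<close>. This polynomial vanishes on \<open>R\<close>, but the
  complementary factor has too small a degree to do so.
\<close>

lemma pirreducible_has_root:
  assumes p: "p \<in> carrier ((fixed 1)[X])" and irr: "pirreducible (fixed 1) p" and dvd: "degree p dvd m"
  shows "\<exists>x\<in>carrier R. eval p x = \<zero>"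
proof (rule ccontr)
  assume noroot: "\<not> (\<exists>x\<in>carrier R. eval p x = \<zero>)"
  let ?K = "fixed 1" and ?n = "q ^ m"
  let ?L = "Rupt ?K p"
  let ?Xn = "X [^]\<^bsub>?K[X]\<^esub> ?n"
  let ?g = "?Xn \<ominus>\<^bsub>?K[X]\<^esub> X"
  interpret P: domain "?K[X]"
    by (rule univ_poly_is_domain[OF subring_fixed])
  interpret L: field ?L
    using rupture_is_field_iff_pirreducible[OF subfield_fixed p] irr by blast
  interpret h: ring_hom_ring "?K[X]" ?L "rupture_surj ?K p"
    by (rule rupture_surj_hom(2)[OF subring_fixed p])
  have p_nz: "p \<noteq> []"
    using pirreducibleE(1)[OF subring_fixed p irr] .
  have deg_p: "degree p \<ge> 1"
    using pirreducible_degree[OF subfield_fixed p irr] .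
  have X: "X \<in> carrier (?K[X])"
    using var_closed(1)[OF subring_fixed] .
  have Xn: "?Xn \<in> carrier (?K[X])"
    by (rule var_pow_closed[OF subring_fixed])
  have g: "?g \<in> carrier (?K[X])"
    using X Xn by (rule P.minus_closed[rotated])
  have n: "?n \<ge> 2"
    using q_gt_1 m_ge_1 one_less_power[of q m] by simp
  have len_Xn: "length ?Xn = Suc ?n"
    using unitary_monom_eq_var_pow[OF subring_fixed, of 1 ?n] by (simp add: monom_def flip: unitary_monom_eq_var_pow[OF subring_fixed])
  have len_X: "length X = 2"
    by (simp add: var_def)
  have "?g \<noteq> []"
  proof
    assume "?g = []"
    then have "?Xn = X"
      using P.r_right_minus_eq[OF Xn X] by (simp add: univ_poly_zero)
    then show False
      using len_X len_Xn n by simp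
  qed
  have "rupture_surj ?K p ?g = \<zero>\<^bsub>?L\<^esub>"
  proof -
    let ?x = "rupture_surj ?K p X"
    have x: "?x \<in> carrier ?L"
      using X by (rule h.hom_closed)
    have fin: "finite (carrier ?L)" and card: "card (carrier ?L) = q ^ degree p"
      using card_rupture[OF subfield_fixed finite_fixed p p_nz] card_fixed_1 by simp_all
    \<comment> \<open>Since \<open>degree p\<close> divides \<open>m\<close>, the exponent
      \<open>q ^ m\<close> is a power of the order of \<open>?L\<close>.\<close>
    obtain c where c: "m = degree p * c"
      using dvd ..
    have "?x [^]\<^bsub>?L\<^esub> ?n = ?x"
      using L.nat_pow_power_fixed[OF x L.pow_card_carrier[OF fin x], of c]
      unfolding card c power_mult .
    moreover have "rupture_surj ?K p ?Xn = ?x [^]\<^bsub>?L\<^esub> ?n"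
      using X by (rule h.hom_nat_pow)
    ultimately have "rupture_surj ?K p ?g = ?x \<ominus>\<^bsub>?L\<^esub> ?x"
      using X Xn by (simp add: a_minus_def del: One_nat_def)
    then show ?thesis
      using x by (simp del: One_nat_def)
  qed
  also have "\<zero>\<^bsub>?L\<^esub> = rupture_surj ?K p []"
    using h.hom_zero by (simp add: univ_poly_zero)
  \<comment> \<open>Both \<open>?g pmod p\<close> and \<open>[]\<close> are remainders modulo
    \<open>p\<close>, and the projection is injective on those.\<close>
  finally have "rupture_surj ?K p (?g pmod p) = rupture_surj ?K p []"
    using rupture_surj_composed_with_pmod[OF subfield_fixed p g] by simp
  moreover have "?g pmod p \<in> (\<lambda>q. q pmod p) ` carrier (?K[X])"
    using g by blast
  moreover have "[] \<in> (\<lambda>q. q pmod p) ` carrier (?K[X])"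
    unfolding pmod_image_characterization[OF subfield_fixed p p_nz] by (simp add: univ_poly_zero_closed)
  ultimately have "?g pmod p = []"
    using rupture_surj_inj_on[OF subfield_fixed p] by (meson inj_onD)
  then have "p divides\<^bsub>?K[X]\<^esub> ?g"
    using pmod_zero_iff_pdivides[OF subfield_fixed g p] pdivides_iff_shell[OF subfield_fixed p g] by blast
  then obtain r where r: "r \<in> carrier (?K[X])" "?g = p \<otimes>\<^bsub>?K[X]\<^esub> r"
    by (auto simp: factor_def)
  have r_nz: "r \<noteq> []"
    using r \<open>?g \<noteq> []\<close> P.r_null[OF p] by (auto simp: univ_poly_zero)
  have "degree ?g = degree p + degree r"
    using poly_mult_degree_eq[OF subring_fixed, of _ p r] p r p_nz r_nz
    by (simp add: univ_poly_carrier univ_poly_mult)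
  moreover have "length ?g \<le> Suc ?n"
    using length_minus_poly_le[OF subring_fixed Xn X] len_X len_Xn n by simp
  moreover have "?n \<le> degree r"
  proof -
    \<comment> \<open>As \<open>p\<close> has no zero in \<open>R\<close> by assumption, the factor
      \<open>r\<close> must vanish wherever \<open>?g\<close> does.\<close>
    have "eval r y = \<zero>" if y: "y \<in> carrier R" for y
    proof -
      interpret e: ring_hom_ring "?K[X]" R "\<lambda>p. eval p y"
        by (rule eval_ring_hom[OF subring_fixed y])
      have "eval ?Xn y = y [^] ?n"
        using e.hom_nat_pow[OF X] eval_var[OF y] by simp
      then have "eval ?g y = \<zero>"
        using eval_minus[OF subring_fixed Xn X y] eval_var[OF y] pow_card[OF y] y by simp
      then have "eval p y \<otimes> eval r y = \<zero>"
        using eval_mult[OF subring_fixed p r(1) y] r(2) by simp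
      then show ?thesis
        using noroot y integral[of "eval p y" "eval r y"] e.hom_closed[OF p] e.hom_closed[OF r(1)] by blast
    qed
    then have "{y \<in> carrier R. eval r y = \<zero>} = carrier R"
      by blast
    then show ?thesis
      using card_zeros_le_degree[OF fixed_poly_carrier[OF r(1)] r_nz] card_R by simp
  qed
  ultimately show False
    using deg_p by linarith
qed

text \<open>As \<open>k dvd m\<close>, a monic irreducible polynomial of degree \<open>k\<close> has
  a root in \<open>R\<close> and is the minimal polynomial of that root, whose period is the
  degree.\<close>

lemma num_monic_irreducible_eq:
  assumes "k dvd m"
  shows "num_monic_irreducible R q k = card (minpoly ` {x \<in> carrier R. period frob x = k})"
proof -
  have "{p \<in> carrier ((fixed 1)[X]). pirreducible (fixed 1) p \<and> degree p = k \<and> lead_coeff p = \<one>}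
      = minpoly ` {x \<in> carrier R. period frob x = k}" (is "?P = ?M")
  proof (intro equalityI subsetI)
    fix p assume p: "p \<in> ?P"
    then obtain x where x: "x \<in> carrier R" "eval p x = \<zero>"
      using pirreducible_has_root[of p] assms by auto
    then have "p = minpoly x"
      using p by (intro minpoly_unique) auto
    then show "p \<in> ?M"
      using p x(1) degree_minpoly[OF x(1)] by auto
  next
    fix p assume "p \<in> ?M"
    then obtain x where x: "x \<in> carrier R" "period frob x = k" "p = minpoly x"
      by blast
    then show "p \<in> ?P"
      using minpoly_props[OF x(1) x(1)] degree_minpoly[OF x(1)] by simp
  qed
  then show ?thesis
    by (simp only: num_monic_irreducible_def subfield_of_card_q)
qed

sublocale labelled_action "carrier R" frob m minpoly "num_monic_irreducible R q"
  by unfold_locales (fact minpoly_eq_iff, fact num_monic_irreducible_eq)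

end

theorem corollary14:
  fixes R :: "('a, 'b) ring_scheme" and q m :: nat
  assumes "primepow q" and "m \<ge> 1"
    and "field R" and "finite (carrier R)" and "card (carrier R) = q ^ m"
  shows "units_of (T_monoid R q m) \<cong>
    product_group {k. k dvd m}
      (\<lambda>k. sym_semidirect_cyclic (num_monic_irreducible R q k) k)"
proof -
  interpret finite_field_power R q m
    using assms by (simp add: finite_field_power_def finite_field_power_axioms_def)
  show ?thesis
    unfolding units_of_T_monoid by (rule bij_centralizer_iso_wreath_product)
qed

end
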